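(* Every Villadsen algebra $B$ is singly generated, i.e., there is an element $b\in B$ such that the smallest C*-subalgebra of $B$ containing $b$ is $B$ itself.
   Context: $\mathbb N=\{1,2,3,\dots\}$. Villadsen algebra. Let $(c_i)_{i\in\mathbb N}$, $(k_i)_{i\in\mathbb N}$, $(l_i)_{i\in\mathbb N}$ be sequences of natural numbers, $X$ a (nonempty) compact connected metric space, $X_1=X$, $X_{i+1}=X_i^{c_i}$, and for each $i\in\mathbb N$ let $E_i=\{x_{i,1},\dots,x_{i,k_i}\}$ be a set of cardinality $k_i$, such that for each $i\in\mathbb N$: (1) $E_i\subseteq X_i$; (2) the set $$E_{i+1}\cup\Big(\bigcup_{s=1}^{c_{i+1}}\pi_s(E_{i+2})\Big)\cup\Big(\bigcup_{j=3}^\infty\ \bigcup_{s=1}^{c_{i+1}\cdots c_{i+j-1}}\pi_s(E_{i+j})\Big)$$ is dense in $X_{i+1}$, where $\pi_s$ denotes the coordinate projection $X_{i+j}=X_{i+1}^{c_{i+1}\cdots c_{i+j-1}}\to X_{i+1}$; (3) $\lim_{i\to\infty}\frac{l_1\cdots l_i}{(l_1+k_1)\cdots(l_i+k_i)}\neq0$. A Villadsen algebra is the limit of an inductive sequence $(B_i,\phi_i)_{i\in\mathbb N}$, where $B_i=\mathrm{M}_{n_{i-1}}(\mathrm{C}(X_i))$, $n_0\in\mathbb N$, $n_i=n_{i-1}(l_i+k_i)$, and the seed of $\phi_i\colon B_i\to B_{i+1}$ is $$\mathrm{C}(X_i)\ni f\mapsto\mathrm{diag}\big\{\underbrace{f\circ\pi_1,\dots,f\circ\pi_1}_{s_{i,1}},\dots,\underbrace{f\circ\pi_{c_i},\dots,f\circ\pi_{c_i}}_{s_{i,c_i}},f(x_{i,1}),\dots,f(x_{i,k_i})\big\}\in\mathrm{M}_{l_i+k_i}(\mathrm{C}(X_{i+1})),$$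 with $s_{i,t}\in\mathbb N$ for $1\le t\le c_i$ and $s_{i,1}+\cdots+s_{i,c_i}=l_i$. Having this seed means that $\phi_i$ is the amplification of the seed to $n_{i-1}\times n_{i-1}$ matrices: up to a fixed permutation of coordinates, $\phi_i(F)$ is the block-diagonal matrix with the same list of entries with $f$ replaced by $F\in\mathrm{M}_{n_{i-1}}(\mathrm{C}(X_i))$. *)

theory Defs
  imports
    "HOL-Analysis.Analysis"
    "HOL-Algebra.Congruence"
    "HOL-Combinatorics.Permutations"
    "Jordan_Normal_Form.Schur_Decomposition"
begin

section \<open>C*-algebras\<close>

text \<open>Not necessarily unital, and given on a carrier set.\<close>

record 'a star_algebra = "'a partial_object" +
  zero_el :: 'a  ("\<^bold>0\<index>")
  plus_el :: "'a \<Rightarrow> 'a \<Rightarrow> 'a"  (infixl "\<^bold>+\<index>" 65)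
  scale_el :: "complex \<Rightarrow> 'a \<Rightarrow> 'a"  (infixr "\<^bold>\<cdot>\<index>" 75)
  times_el :: "'a \<Rightarrow> 'a \<Rightarrow> 'a"  (infixl "\<^bold>*\<index>" 70)
  star_el :: "'a \<Rightarrow> 'a"  ("star\<index>")
  norm_el :: "'a \<Rightarrow> real"  ("nrm\<index>")

definition dist_el :: "('a, 'm) star_algebra_scheme \<Rightarrow> 'a \<Rightarrow> 'a \<Rightarrow> real" where
  "dist_el A a b = norm_el A (plus_el A a (scale_el A (-1) b))"

locale cstar_algebra =
  fixes A (structure)
  assumes zero_closed: "\<^bold>0 \<in> carrier A"
    and plus_closed: "\<lbrakk>a \<in> carrier A; b \<in> carrier A\<rbrakk> \<Longrightarrow> a \<^bold>+ b \<in> carrier A"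
    and scale_closed: "a \<in> carrier A \<Longrightarrow> z \<^bold>\<cdot> a \<in> carrier A"
    and times_closed: "\<lbrakk>a \<in> carrier A; b \<in> carrier A\<rbrakk> \<Longrightarrow> a \<^bold>* b \<in> carrier A"
    and star_closed: "a \<in> carrier A \<Longrightarrow> star a \<in> carrier A"
    \<comment> \<open>complex vector space\<close>
    and plus_assoc: "\<lbrakk>a \<in> carrier A; b \<in> carrier A; d \<in> carrier A\<rbrakk>
          \<Longrightarrow> (a \<^bold>+ b) \<^bold>+ d = a \<^bold>+ (b \<^bold>+ d)"
    and plus_commute: "\<lbrakk>a \<in> carrier A; b \<in> carrier A\<rbrakk> \<Longrightarrow> a \<^bold>+ b = b \<^bold>+ a"
    and plus_zero: "a \<in> carrier A \<Longrightarrow> a \<^bold>+ \<^bold>0 = a"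
    and plus_minus: "a \<in> carrier A \<Longrightarrow> a \<^bold>+ (-1) \<^bold>\<cdot> a = \<^bold>0"
    and scale_one: "a \<in> carrier A \<Longrightarrow> 1 \<^bold>\<cdot> a = a"
    and scale_scale: "a \<in> carrier A \<Longrightarrow> z \<^bold>\<cdot> w \<^bold>\<cdot> a = (z * w) \<^bold>\<cdot> a"
    and scale_plus_right: "\<lbrakk>a \<in> carrier A; b \<in> carrier A\<rbrakk>
          \<Longrightarrow> z \<^bold>\<cdot> (a \<^bold>+ b) = z \<^bold>\<cdot> a \<^bold>+ z \<^bold>\<cdot> b"
    and scale_plus_left: "a \<in> carrier A \<Longrightarrow> (z + w) \<^bold>\<cdot> a = z \<^bold>\<cdot> a \<^bold>+ w \<^bold>\<cdot> a"
    \<comment> \<open>associative algebra\<close>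
    and times_assoc: "\<lbrakk>a \<in> carrier A; b \<in> carrier A; d \<in> carrier A\<rbrakk>
          \<Longrightarrow> (a \<^bold>* b) \<^bold>* d = a \<^bold>* (b \<^bold>* d)"
    and plus_times: "\<lbrakk>a \<in> carrier A; b \<in> carrier A; d \<in> carrier A\<rbrakk>
          \<Longrightarrow> (a \<^bold>+ b) \<^bold>* d = a \<^bold>* d \<^bold>+ b \<^bold>* d"
    and times_plus: "\<lbrakk>a \<in> carrier A; b \<in> carrier A; d \<in> carrier A\<rbrakk>
          \<Longrightarrow> a \<^bold>* (b \<^bold>+ d) = a \<^bold>* b \<^bold>+ a \<^bold>* d"
    and scale_times: "\<lbrakk>a \<in> carrier A; b \<in> carrier A\<rbrakk>
          \<Longrightarrow> (z \<^bold>\<cdot> a) \<^bold>* b = z \<^bold>\<cdot> (a \<^bold>* b)"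
    and times_scale: "\<lbrakk>a \<in> carrier A; b \<in> carrier A\<rbrakk>
          \<Longrightarrow> a \<^bold>* (z \<^bold>\<cdot> b) = z \<^bold>\<cdot> (a \<^bold>* b)"
    \<comment> \<open>involution\<close>
    and star_star: "a \<in> carrier A \<Longrightarrow> star (star a) = a"
    and star_plus: "\<lbrakk>a \<in> carrier A; b \<in> carrier A\<rbrakk> \<Longrightarrow> star (a \<^bold>+ b) = star a \<^bold>+ star b"
    and star_scale: "a \<in> carrier A \<Longrightarrow> star (z \<^bold>\<cdot> a) = cnj z \<^bold>\<cdot> star a"
    and star_times: "\<lbrakk>a \<in> carrier A; b \<in> carrier A\<rbrakk> \<Longrightarrow> star (a \<^bold>* b) = star b \<^bold>* star a"
    \<comment> \<open>complete submultiplicative norm satisfying the C*-identity\<close>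
    and norm_eq_0: "a \<in> carrier A \<Longrightarrow> nrm a = 0 \<longleftrightarrow> a = \<^bold>0"
    and norm_triangle: "\<lbrakk>a \<in> carrier A; b \<in> carrier A\<rbrakk> \<Longrightarrow> nrm (a \<^bold>+ b) \<le> nrm a + nrm b"
    and norm_scale: "a \<in> carrier A \<Longrightarrow> nrm (z \<^bold>\<cdot> a) = cmod z * nrm a"
    and norm_times: "\<lbrakk>a \<in> carrier A; b \<in> carrier A\<rbrakk> \<Longrightarrow> nrm (a \<^bold>* b) \<le> nrm a * nrm b"
    and cstar_identity: "a \<in> carrier A \<Longrightarrow> nrm (star a \<^bold>* a) = (nrm a)\<^sup>2"
    and complete: "\<lbrakk>\<And>n. u n \<in> carrier A;
          \<And>e. e > 0 \<Longrightarrow> \<exists>N. \<forall>m\<ge>N. \<forall>n\<ge>N. dist_el A (u m) (u n) < e\<rbrakk>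
          \<Longrightarrow> \<exists>a\<in>carrier A. (\<lambda>n. dist_el A (u n) a) \<longlonglongrightarrow> 0"

text \<open>A C*-subalgebra is a norm-closed *-subalgebra; even if \<open>A\<close> has a unit, the
  subalgebra is not required to contain it.\<close>

definition cstar_subalgebra :: "('a, 'm) star_algebra_scheme \<Rightarrow> 'a set \<Rightarrow> bool" where
  "cstar_subalgebra A S \<longleftrightarrow>
     S \<subseteq> carrier A \<and> zero_el A \<in> S \<and>
     (\<forall>a\<in>S. \<forall>b\<in>S. plus_el A a b \<in> S) \<and>
     (\<forall>z. \<forall>a\<in>S. scale_el A z a \<in> S) \<and>
     (\<forall>a\<in>S. \<forall>b\<in>S. times_el A a b \<in> S) \<and>
     (\<forall>a\<in>S. star_el A a \<in> S) \<and>
     (\<forall>u. \<forall>a\<in>carrier A. (\<forall>n. u n \<in> S) \<and> (\<lambda>n::nat. dist_el A (u n) a) \<longlonglongrightarrow> 0 \<longrightarrow> a \<in> S)"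

definition cstar_generated :: "('a, 'm) star_algebra_scheme \<Rightarrow> 'a \<Rightarrow> 'a set" where
  "cstar_generated A b = \<Inter>{S. cstar_subalgebra A S \<and> b \<in> S}"

definition singly_generated :: "('a, 'm) star_algebra_scheme \<Rightarrow> bool" where
  "singly_generated A \<longleftrightarrow> (\<exists>b\<in>carrier A. cstar_generated A b = carrier A)"

definition star_hom ::
  "('a, 'm) star_algebra_scheme \<Rightarrow> ('b, 'n) star_algebra_scheme \<Rightarrow> ('a \<Rightarrow> 'b) \<Rightarrow> bool" where
  "star_hom A B f \<longleftrightarrow>
     (\<forall>a\<in>carrier A. f a \<in> carrier B) \<and>
     (\<forall>a\<in>carrier A. \<forall>b\<in>carrier A. f (plus_el A a b) = plus_el B (f a) (f b)) \<and>
     (\<forall>z. \<forall>a\<in>carrier A. f (scale_el A z a) = scale_el B z (f a)) \<and>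
     (\<forall>a\<in>carrier A. \<forall>b\<in>carrier A. f (times_el A a b) = times_el B (f a) (f b)) \<and>
     (\<forall>a\<in>carrier A. f (star_el A a) = star_el B (f a))"


section \<open>Inductive limits\<close>

text \<open>\<open>connecting_map \<phi> i m\<close> is the composite of \<open>\<phi> i, \<dots>, \<phi> (i + m - 1)\<close>, from the
  \<open>i\<close>-th to the \<open>(i + m)\<close>-th algebra.\<close>

primrec connecting_map :: "(nat \<Rightarrow> 'a \<Rightarrow> 'a) \<Rightarrow> nat \<Rightarrow> nat \<Rightarrow> 'a \<Rightarrow> 'a" where
  "connecting_map \<phi> i 0 = id"
| "connecting_map \<phi> i (Suc m) = \<phi> (i + m) \<circ> connecting_map \<phi> i m"

text \<open>\<open>B\<close> is the completion of the algebraic direct limit of \<open>(A i, \<phi> i)\<close> for the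
  seminorm sending the class of \<open>a \<in> A i\<close> to the limit of the norms of its images in
  \<open>A (i + m)\<close> as \<open>m\<close> grows, with canonical maps \<open>\<psi> i\<close>.\<close>

definition inductive_limit ::
  "(nat \<Rightarrow> ('a, 'm) star_algebra_scheme) \<Rightarrow> (nat \<Rightarrow> 'a \<Rightarrow> 'a)
    \<Rightarrow> ('b, 'n) star_algebra_scheme \<Rightarrow> (nat \<Rightarrow> 'a \<Rightarrow> 'b) \<Rightarrow> bool" where
  "inductive_limit A \<phi> B \<psi> \<longleftrightarrow>
     cstar_algebra B \<and>
     (\<forall>i. star_hom (A i) B (\<psi> i)) \<and>
     (\<forall>i. \<forall>a\<in>carrier (A i). \<psi> (Suc i) (\<phi> i a) = \<psi> i a) \<and>
     (\<forall>i. \<forall>a\<in>carrier (A i).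
        (\<lambda>m. norm_el (A (i + m)) (connecting_map \<phi> i m a)) \<longlonglongrightarrow> norm_el B (\<psi> i a)) \<and>
     (\<forall>b\<in>carrier B. \<forall>e>0. \<exists>i. \<exists>a\<in>carrier (A i). dist_el B (\<psi> i a) b < e)"


section \<open>Matrix algebras over algebras of continuous functions\<close>

definition mat_op_norm :: "complex mat \<Rightarrow> real" where
  "mat_op_norm M =
     Sup {L2_set (\<lambda>p. cmod (vec_index (M *\<^sub>v v) p)) {..<dim_row M} | v.
            v \<in> carrier_vec (dim_col M) \<and> L2_set (\<lambda>p. cmod (vec_index v p)) {..<dim_col M} \<le> 1}"

text \<open>The \<open>n \<times> n\<close> matrices over the continuous functions on \<open>Y\<close>, as matrix-valued functions
  with continuous entries. Extensionality (value \<open>undefined\<close> off \<open>Y\<close>) makes equality of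
  elements agree with equality of functions on \<open>Y\<close>.\<close>

definition matrix_algebra ::
  "'y::topological_space set \<Rightarrow> nat \<Rightarrow> ('y \<Rightarrow> complex mat) star_algebra" where
  "matrix_algebra Y n =
     \<lparr> carrier = {F \<in> Y \<rightarrow>\<^sub>E carrier_mat n n.
         \<forall>p<n. \<forall>q<n. continuous_on Y (\<lambda>y. F y $$ (p, q))},
       zero_el = (\<lambda>y\<in>Y. 0\<^sub>m n n),
       plus_el = (\<lambda>F G. \<lambda>y\<in>Y. F y + G y),
       scale_el = (\<lambda>z F. \<lambda>y\<in>Y. z \<cdot>\<^sub>m F y),
       times_el = (\<lambda>F G. \<lambda>y\<in>Y. F y * G y),
       star_el = (\<lambda>F. \<lambda>y\<in>Y. mat_adjoint (F y)),
       norm_el = (\<lambda>F. SUP y\<in>Y. mat_op_norm (F y)) \<rparr>"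


section \<open>Villadsen algebras\<close>

text \<open>All sequences start at index \<open>0\<close>: \<open>X\<^sub>i\<close>, \<open>c\<^sub>i\<close>, \<open>k\<^sub>i\<close>, \<open>l\<^sub>i\<close>, \<open>s\<^sub>i\<^sub>,\<^sub>t\<close>, \<open>x\<^sub>i\<^sub>,\<^sub>j\<close> here are
  \<open>X\<^sub>i\<^sub>+\<^sub>1\<close>, \<open>c\<^sub>i\<^sub>+\<^sub>1\<close>, \<open>\<dots>\<close>, \<open>x\<^sub>i\<^sub>+\<^sub>1\<^sub>,\<^sub>j\<^sub>+\<^sub>1\<close> in the numbering from \<open>1\<close>, whereas \<open>n\<^sub>i\<close> keeps its
  numbering, so that \<open>B\<^sub>i\<close> consists of \<open>n\<^sub>i \<times> n\<^sub>i\<close> matrices.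

  The iterated power \<open>X\<^sub>i\<close> is identified with the power of \<open>X\<close> with exponent
  \<open>c\<^sub>0 \<cdots> c\<^sub>i\<^sub>-\<^sub>1\<close>, whose elements are families supported on an initial segment of the naturals
  (with the subspace topology of the product topology on \<open>nat \<Rightarrow> 'a\<close>).\<close>

definition villadsen_dim :: "(nat \<Rightarrow> nat) \<Rightarrow> nat \<Rightarrow> nat" where
  "villadsen_dim c i = (\<Prod>j<i. c j)"

definition villadsen_space :: "'a set \<Rightarrow> (nat \<Rightarrow> nat) \<Rightarrow> nat \<Rightarrow> (nat \<Rightarrow> 'a) set" where
  "villadsen_space X c i = {..<villadsen_dim c i} \<rightarrow>\<^sub>E X"

text \<open>The \<open>s\<close>-th coordinate projection of a power of the \<open>d\<close>-fold product onto that
  \<open>d\<close>-fold product: the \<open>s\<close>-th block of length \<open>d\<close>.\<close>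

definition block_proj :: "nat \<Rightarrow> nat \<Rightarrow> (nat \<Rightarrow> 'a) \<Rightarrow> nat \<Rightarrow> 'a" where
  "block_proj d s y = (\<lambda>t\<in>{..<d}. y (s * d + t))"

definition villadsen_size :: "(nat \<Rightarrow> nat) \<Rightarrow> (nat \<Rightarrow> nat) \<Rightarrow> nat \<Rightarrow> nat \<Rightarrow> nat" where
  "villadsen_size k l n0 i = n0 * (\<Prod>j<i. l j + k j)"

text \<open>\<open>E\<^sub>i = {x\<^sub>i\<^sub>,\<^sub>j | j < k\<^sub>i}\<close>. In the density condition, \<open>i\<close> is the index of the space in which
  density is required (there is no condition for \<open>i = 0\<close>); the union over \<open>j \<ge> 1\<close> has
  \<open>c\<^sub>i \<cdots> c\<^sub>i\<^sub>+\<^sub>j\<^sub>-\<^sub>1\<close> projections at stage \<open>j\<close>. The \<open>\<sigma> i\<close> are the coordinate permutations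
  allowed in the amplification of the seeds.\<close>

locale villadsen_data =
  fixes X :: "'a::metric_space set"
    and c k l :: "nat \<Rightarrow> nat"
    and s :: "nat \<Rightarrow> nat \<Rightarrow> nat"
    and x :: "nat \<Rightarrow> nat \<Rightarrow> nat \<Rightarrow> 'a"
    and n0 :: nat
    and \<sigma> :: "nat \<Rightarrow> nat \<Rightarrow> nat"
  assumes X_compact: "compact X"
    and X_connected: "connected X"
    and X_nonempty: "X \<noteq> {}"
    and c_pos: "c i \<ge> 1"
    and k_pos: "k i \<ge> 1"
    and l_pos: "l i \<ge> 1"
    and n0_pos: "n0 \<ge> 1"
    and E_subset: "x i ` {..<k i} \<subseteq> villadsen_space X c i"
    and E_card: "card (x i ` {..<k i}) = k i"
    and E_dense: "i \<ge> 1 \<Longrightarrow>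
      villadsen_space X c i \<subseteq> closure
        (x i ` {..<k i} \<union>
         (\<Union>j\<in>{1..}. \<Union>r<(\<Prod>t\<in>{i..<i + j}. c t).
            block_proj (villadsen_dim c i) r ` x (i + j) ` {..<k (i + j)}))"
    and ratio_limit: "\<exists>L. L \<noteq> 0 \<and>
      (\<lambda>i. real (\<Prod>j\<le>i. l j) / real (\<Prod>j\<le>i. l j + k j)) \<longlonglongrightarrow> L"
    and s_pos: "t < c i \<Longrightarrow> s i t \<ge> 1"
    and s_sum: "(\<Sum>t<c i. s i t) = l i"
    and \<sigma>_permutes: "\<sigma> i permutes {..<villadsen_size k l n0 (Suc i)}"

definition villadsen_block ::
  "'a::metric_space set \<Rightarrow> (nat \<Rightarrow> nat) \<Rightarrow> (nat \<Rightarrow> nat) \<Rightarrow> (nat \<Rightarrow> nat) \<Rightarrow> nat \<Rightarrow> nat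
    \<Rightarrow> ((nat \<Rightarrow> 'a) \<Rightarrow> complex mat) star_algebra" where
  "villadsen_block X c k l n0 i =
     matrix_algebra (villadsen_space X c i) (villadsen_size k l n0 i)"

text \<open>The list of diagonal blocks of the image of \<open>F\<close> at the point \<open>y\<close>.\<close>

definition villadsen_diag ::
  "(nat \<Rightarrow> nat) \<Rightarrow> (nat \<Rightarrow> nat) \<Rightarrow> (nat \<Rightarrow> nat \<Rightarrow> nat) \<Rightarrow> (nat \<Rightarrow> nat \<Rightarrow> nat \<Rightarrow> 'a) \<Rightarrow> nat
    \<Rightarrow> ((nat \<Rightarrow> 'a) \<Rightarrow> complex mat) \<Rightarrow> (nat \<Rightarrow> 'a) \<Rightarrow> complex mat list" where
  "villadsen_diag c k s x i F y =
     concat (map (\<lambda>t. replicate (s i t) (F (block_proj (villadsen_dim c i) t y))) [0..<c i])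
     @ map (\<lambda>j. F (x i j)) [0..<k i]"

definition villadsen_map ::
  "'a::metric_space set \<Rightarrow> (nat \<Rightarrow> nat) \<Rightarrow> (nat \<Rightarrow> nat) \<Rightarrow> (nat \<Rightarrow> nat)
    \<Rightarrow> (nat \<Rightarrow> nat \<Rightarrow> nat) \<Rightarrow> (nat \<Rightarrow> nat \<Rightarrow> nat \<Rightarrow> 'a) \<Rightarrow> nat \<Rightarrow> (nat \<Rightarrow> nat \<Rightarrow> nat) \<Rightarrow> nat
    \<Rightarrow> ((nat \<Rightarrow> 'a) \<Rightarrow> complex mat) \<Rightarrow> (nat \<Rightarrow> 'a) \<Rightarrow> complex mat" where
  "villadsen_map X c k l s x n0 \<sigma> i F =
     (let N = villadsen_size k l n0 (Suc i) in
      (\<lambda>y\<in>villadsen_space X c (Suc i).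
        Matrix.mat N N
          (\<lambda>(p, q). diag_block_mat (villadsen_diag c k s x i F y) $$ (\<sigma> i p, \<sigma> i q))))"

text \<open>\<open>B\<close> is a Villadsen algebra for the given data. The canonical maps \<open>\<psi>\<close> are only
  required to exist.\<close>

definition is_villadsen_algebra ::
  "'a::metric_space set \<Rightarrow> (nat \<Rightarrow> nat) \<Rightarrow> (nat \<Rightarrow> nat) \<Rightarrow> (nat \<Rightarrow> nat)
    \<Rightarrow> (nat \<Rightarrow> nat \<Rightarrow> nat) \<Rightarrow> (nat \<Rightarrow> nat \<Rightarrow> nat \<Rightarrow> 'a) \<Rightarrow> nat \<Rightarrow> (nat \<Rightarrow> nat \<Rightarrow> nat)
    \<Rightarrow> ('b, 'm) star_algebra_scheme \<Rightarrow> bool" where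
  "is_villadsen_algebra X c k l s x n0 \<sigma> B \<longleftrightarrow>
     villadsen_data X c k l s x n0 \<sigma> \<and>
     (\<exists>\<psi>. inductive_limit (villadsen_block X c k l n0)
             (villadsen_map X c k l s x n0 \<sigma>) B \<psi>)"

end

theory Submission
  imports Defs
begin

text \<open>The algebra is generated by the matrix units of all levels together with the images \<open>F\<^sub>n\<close> of
  countably many real functions separating the points of \<open>X\<close>: conjugating the diagonal matrix
  \<open>F\<^sub>n\<close> by matrix units isolates its entries, these include all coordinate functions on the
  power \<open>X\<^sub>i\<close>, and Stone--Weierstrass does the rest.

  To obtain all of these from one element \<open>d + \<i> h\<close>, with \<open>d\<close> and \<open>h\<close> self-adjoint, let
  \<open>d\<close> be the sum of all diagonal matrix units of all levels with rapidly decaying weights; these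
  are commuting projections, and each of them is recovered from \<open>d\<close> by iterating \<open>3 x\<^sup>2 - 2 x\<^sup>3\<close>.
  Let \<open>h\<close> be a weighted sum of the elements \<open>e\<^sub>r\<^sub>s (1 + F\<^sub>j)\<close> and their adjoints, where \<open>r, s\<close> are
  indices at level \<open>j + 1\<close> with the same parent at level \<open>j\<close>, \<open>r\<close> is the last child and \<open>s\<close> is
  not. These are isolated from each other by the diagonal matrix units, and a Newton iteration
  splits \<open>e\<^sub>r\<^sub>s (1 + F\<^sub>j)\<close> into \<open>e\<^sub>r\<^sub>s\<close> and \<open>e\<^sub>s\<^sub>s F\<^sub>j\<close>. The entries \<open>e\<^sub>r\<^sub>r F\<^sub>j\<close> at the last
  children are not lost: there the connecting map is a point evaluation, so they are scalar
  multiples of \<open>e\<^sub>r\<^sub>r\<close>.\<close>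

section \<open>Limits and small perturbations in C*-algebras\<close>

context cstar_algebra
begin

section \<open>Vector space and norm laws on the carrier\<close>

lemmas closed = zero_closed plus_closed scale_closed times_closed star_closed
declare closed [simp]

definition tends :: "(nat \<Rightarrow> 'a) \<Rightarrow> 'a \<Rightarrow> bool" where
  "tends u a \<longleftrightarrow> (\<forall>n. u n \<in> carrier A) \<and> a \<in> carrier A \<and> (\<lambda>n. dist_el A (u n) a) \<longlonglongrightarrow> 0"

lemma zero_plus [simp]: "a \<in> carrier A \<Longrightarrow> \<^bold>0 \<^bold>+ a = a"
  using plus_commute plus_zero by simp

lemma plus_left_commute:
  "\<lbrakk>a \<in> carrier A; b \<in> carrier A; d \<in> carrier A\<rbrakk> \<Longrightarrow> a \<^bold>+ (b \<^bold>+ d) = b \<^bold>+ (a \<^bold>+ d)"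
  by (metis plus_assoc plus_commute)

lemmas plus_ac = plus_assoc plus_commute plus_left_commute

declare plus_zero [simp] scale_one [simp]

lemma zero_scale [simp]: "a \<in> carrier A \<Longrightarrow> 0 \<^bold>\<cdot> a = \<^bold>0"
  using scale_plus_left[of a 1 "-1"] plus_minus by simp

lemma scale_zero [simp]: "z \<^bold>\<cdot> \<^bold>0 = \<^bold>0"
  using scale_scale[of "\<^bold>0" z 0] by simp

lemma times_zero [simp]: "a \<in> carrier A \<Longrightarrow> a \<^bold>* \<^bold>0 = \<^bold>0"
  using times_scale[of a "\<^bold>0" 0] by simp

lemma zero_times [simp]: "a \<in> carrier A \<Longrightarrow> \<^bold>0 \<^bold>* a = \<^bold>0"
  using scale_times[of "\<^bold>0" a 0] by simp

lemma star_zero [simp]: "star \<^bold>0 = \<^bold>0"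
  using star_scale[of "\<^bold>0" 0] by simp

lemma norm_zero [simp]: "nrm \<^bold>0 = 0"
  using norm_eq_0 by simp

lemma norm_nonneg [simp]: "a \<in> carrier A \<Longrightarrow> 0 \<le> nrm a"
  using norm_triangle[of a "(-1) \<^bold>\<cdot> a"] norm_scale[of a "-1"] plus_minus[of a] by simp

text \<open>The C*-identity and submultiplicativity give
  \<open>(nrm a)\<^sup>2 \<le> nrm (star a) * nrm a\<close>; a factor \<open>nrm a\<close> cancels
  unless it is zero.\<close>

lemma norm_star_le: "a \<in> carrier A \<Longrightarrow> nrm a \<le> nrm (star a)"
  using cstar_identity[of a] norm_times[of "star a" a] norm_nonneg[of a] norm_nonneg[of "star a"]
    less_le[of 0 "nrm a"]
  by (cases "nrm a = 0") (auto simp: power2_eq_square mult_le_cancel_right)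

lemma norm_star [simp]: "a \<in> carrier A \<Longrightarrow> nrm (star a) = nrm a"
  using norm_star_le[of a] norm_star_le[of "star a"] by (simp add: star_star)

text \<open>The C*-identity turns the second hypothesis into
  \<open>nrm q = (nrm q)\<^sup>2\<close>.\<close>

lemma norm_projection_le:
  assumes "q \<in> carrier A" "star q \<^bold>* q = q"
  shows "nrm q \<le> 1"
  using cstar_identity[of q] assms norm_nonneg[of q]
  by (cases "nrm q = 0") (auto simp: power2_eq_square)

lemma minus_plus_cancel:
  "\<lbrakk>a \<in> carrier A; b \<in> carrier A\<rbrakk> \<Longrightarrow> b \<^bold>+ (a \<^bold>+ (-1) \<^bold>\<cdot> b) = a"
  using plus_left_commute[of b a "(-1) \<^bold>\<cdot> b"] plus_minus[of b] by simp

lemma plus_minus_cancel: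
  "\<lbrakk>a \<in> carrier A; b \<in> carrier A\<rbrakk> \<Longrightarrow> (b \<^bold>+ a) \<^bold>+ (-1) \<^bold>\<cdot> b = a"
  using minus_plus_cancel plus_assoc by simp

lemma minus_eq_zero:
  assumes "a \<in> carrier A" "b \<in> carrier A" "a \<^bold>+ (-1) \<^bold>\<cdot> b = \<^bold>0"
  shows "a = b"
  using minus_plus_cancel[of a b] assms by simp

section \<open>Distance and norm limits\<close>

lemma dist_nonneg: "\<lbrakk>a \<in> carrier A; b \<in> carrier A\<rbrakk> \<Longrightarrow> 0 \<le> dist_el A a b"
  by (simp add: dist_el_def)

lemma dist_self: "a \<in> carrier A \<Longrightarrow> dist_el A a a = 0"
  by (simp add: dist_el_def plus_minus)

lemma dist_triangle:
  assumes "a \<in> carrier A" "b \<in> carrier A" "d \<in> carrier A"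
  shows "dist_el A a d \<le> dist_el A a b + dist_el A b d"
proof -
  have "a \<^bold>+ (-1) \<^bold>\<cdot> d = (a \<^bold>+ (-1) \<^bold>\<cdot> b) \<^bold>+ (b \<^bold>+ (-1) \<^bold>\<cdot> d)"
    using plus_assoc[of "(-1) \<^bold>\<cdot> b" b "(-1) \<^bold>\<cdot> d"] plus_minus[of b] assms
    by (simp add: plus_assoc plus_commute[of "(-1) \<^bold>\<cdot> b" b])
  then show ?thesis
    unfolding dist_el_def using norm_triangle assms by simp
qed

lemma dist_commute:
  assumes "a \<in> carrier A" "b \<in> carrier A"
  shows "dist_el A a b = dist_el A b a"
proof -
  have "a \<^bold>+ (-1) \<^bold>\<cdot> b = (-1) \<^bold>\<cdot> (b \<^bold>+ (-1) \<^bold>\<cdot> a)"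
    using assms by (simp add: scale_plus_right scale_scale plus_commute)
  then show ?thesis unfolding dist_el_def using norm_scale assms by simp
qed

lemma dist_eq_0: "\<lbrakk>a \<in> carrier A; b \<in> carrier A; dist_el A a b = 0\<rbrakk> \<Longrightarrow> a = b"
  unfolding dist_el_def using norm_eq_0 minus_eq_zero by simp

lemma tendsI_bound:
  assumes "\<And>n. u n \<in> carrier A" "a \<in> carrier A" "\<And>n. dist_el A (u n) a \<le> f n" "f \<longlonglongrightarrow> 0"
  shows "tends u a"
  unfolding tends_def using assms
  by (auto intro!: tendsto_sandwich[OF _ _ tendsto_const assms(4)] always_eventually simp: dist_nonneg)

lemma tends_unique:
  assumes "tends u a" "tends u b"
  shows "a = b"
proof -
  have *: "dist_el A a b \<le> dist_el A (u n) a + dist_el A (u n) b" for n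
    using dist_triangle[of a "u n" b] dist_commute[of a "u n"] assms by (simp add: tends_def)
  have "(\<lambda>n. dist_el A (u n) a + dist_el A (u n) b) \<longlonglongrightarrow> 0 + 0"
    using assms by (intro tendsto_add) (auto simp: tends_def)
  then have "dist_el A a b \<le> 0 + 0"
    by (rule LIMSEQ_le_const) (use * in auto)
  then show ?thesis
    using dist_nonneg[of a b] dist_eq_0[of a b] assms by (simp add: tends_def)
qed

lemma tends_const: "a \<in> carrier A \<Longrightarrow> tends (\<lambda>_. a) a"
  by (simp add: tends_def dist_self)

lemma tends_eventually:
  assumes "tends u a" "b \<in> carrier A" "\<And>n. n \<ge> k \<Longrightarrow> u n = b"
  shows "a = b"
proof (rule tends_unique)
  show "tends (\<lambda>n. u (n + k)) a"
    using assms(1) LIMSEQ_ignore_initial_segment[of "\<lambda>n. dist_el A (u n) a" 0 k]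
    by (simp add: tends_def)
  show "tends (\<lambda>n. u (n + k)) b"
    using assms(2,3) by (simp add: tends_const)
qed

lemma tends_le:
  assumes "tends u a" "b \<in> carrier A" "\<And>n. n \<ge> k \<Longrightarrow> dist_el A (u n) b \<le> K"
  shows "dist_el A a b \<le> K"
proof -
  have *: "dist_el A a b \<le> dist_el A (u n) a + K" if "n \<ge> k" for n
    using dist_triangle[of a "u n" b] dist_commute[of a "u n"] assms that by (force simp: tends_def)
  have "(\<lambda>n. dist_el A (u n) a + K) \<longlonglongrightarrow> 0 + K"
    using assms by (intro tendsto_add) (auto simp: tends_def)
  then have "dist_el A a b \<le> 0 + K"
    by (rule LIMSEQ_le_const) (use * in auto)
  then show ?thesis by simp
qed

lemma dist_times_left:
  assumes "p \<in> carrier A" "a \<in> carrier A" "b \<in> carrier A"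
  shows "dist_el A (p \<^bold>* a) (p \<^bold>* b) \<le> nrm p * dist_el A a b"
proof -
  have "p \<^bold>* a \<^bold>+ (-1) \<^bold>\<cdot> (p \<^bold>* b) = p \<^bold>* (a \<^bold>+ (-1) \<^bold>\<cdot> b)"
    using assms by (simp add: times_plus times_scale)
  then show ?thesis unfolding dist_el_def using norm_times assms by simp
qed

lemma dist_times_right:
  assumes "p \<in> carrier A" "a \<in> carrier A" "b \<in> carrier A"
  shows "dist_el A (a \<^bold>* p) (b \<^bold>* p) \<le> dist_el A a b * nrm p"
proof -
  have "a \<^bold>* p \<^bold>+ (-1) \<^bold>\<cdot> (b \<^bold>* p) = (a \<^bold>+ (-1) \<^bold>\<cdot> b) \<^bold>* p"
    using assms by (simp add: plus_times scale_times)
  then show ?thesis unfolding dist_el_def using norm_times assms by simp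
qed

lemma dist_star:
  assumes "a \<in> carrier A" "b \<in> carrier A"
  shows "dist_el A (star a) (star b) = dist_el A a b"
proof -
  have "star a \<^bold>+ (-1) \<^bold>\<cdot> star b = star (a \<^bold>+ (-1) \<^bold>\<cdot> b)"
    using assms by (simp add: star_plus star_scale)
  then show ?thesis unfolding dist_el_def using assms by simp
qed

lemma tends_times_left: "\<lbrakk>tends u a; p \<in> carrier A\<rbrakk> \<Longrightarrow> tends (\<lambda>n. p \<^bold>* u n) (p \<^bold>* a)"
  by (rule tendsI_bound[where f = "\<lambda>n. nrm p * dist_el A (u n) a"])
    (auto simp: tends_def dist_times_left intro!: tendsto_mult_right_zero)

lemma tends_times_right: "\<lbrakk>tends u a; p \<in> carrier A\<rbrakk> \<Longrightarrow> tends (\<lambda>n. u n \<^bold>* p) (a \<^bold>* p)"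
  by (rule tendsI_bound[where f = "\<lambda>n. dist_el A (u n) a * nrm p"])
    (auto simp: tends_def dist_times_right intro!: tendsto_mult_left_zero)

lemma tends_star: "tends u a \<Longrightarrow> tends (\<lambda>n. star (u n)) (star a)"
  by (simp add: tends_def dist_star)

section \<open>Absolutely convergent series\<close>

primrec psum :: "(nat \<Rightarrow> 'a) \<Rightarrow> nat \<Rightarrow> 'a" where
  "psum w 0 = \<^bold>0"
| "psum w (Suc n) = psum w n \<^bold>+ w n"

lemma psum_closed [simp]: "(\<And>n. w n \<in> carrier A) \<Longrightarrow> psum w n \<in> carrier A"
  by (induction n) auto

lemma dist_psum:
  assumes w: "\<And>n. w n \<in> carrier A" and "m \<le> n"
  shows "dist_el A (psum w n) (psum w m) \<le> (\<Sum>i=m..<n. nrm (w i))"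
  using \<open>m \<le> n\<close>
proof (induction n rule: dec_induct)
  case base
  then show ?case using w by (simp add: dist_self)
next
  case (step n)
  have "dist_el A (psum w (Suc n)) (psum w n) = nrm (w n)"
    using w by (simp add: dist_el_def plus_minus_cancel)
  then show ?case
    using step dist_triangle[of "psum w (Suc n)" "psum w n" "psum w m"] w by simp
qed

text \<open>Summability of the norms makes the partial sums Cauchy, and completeness supplies the
  limit.\<close>

lemma psum_converges:
  assumes w: "\<And>n. w n \<in> carrier A" and "summable (\<lambda>n. nrm (w n))"
  shows "\<exists>a. tends (psum w) a"
proof -
  have "\<exists>a\<in>carrier A. (\<lambda>n. dist_el A (psum w n) a) \<longlonglongrightarrow> 0"
  proof (rule complete)
    fix e :: real
    assume "e > 0"
    then obtain N where N: "\<And>m n. m \<ge> N \<Longrightarrow> norm (\<Sum>i=m..<n. nrm (w i)) < e"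
      using assms(2) unfolding summable_Cauchy by blast
    have *: "dist_el A (psum w n) (psum w m) < e" if "m \<ge> N" "m \<le> n" for m n
      using dist_psum[of w m n] w that(2) N[OF that(1), of n] by simp
    show "\<exists>N. \<forall>m\<ge>N. \<forall>n\<ge>N. dist_el A (psum w m) (psum w n) < e"
    proof (intro exI allI impI)
      fix m n assume "m \<ge> N" "n \<ge> N"
      then show "dist_el A (psum w m) (psum w n) < e"
        using *[of m n] *[of n m] dist_commute[of "psum w m" "psum w n"] w
        by (cases "m \<le> n") auto
    qed
  qed (use w in auto)
  then show ?thesis using w unfolding tends_def by auto
qed

lemma psum_times_left:
  assumes "\<And>n. w n \<in> carrier A" "p \<in> carrier A"
  shows "p \<^bold>* psum w n = psum (\<lambda>n. p \<^bold>* w n) n"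
  using assms by (induction n) (auto simp: times_plus)

lemma psum_times_right:
  assumes "\<And>n. w n \<in> carrier A" "p \<in> carrier A"
  shows "psum w n \<^bold>* p = psum (\<lambda>n. w n \<^bold>* p) n"
  using assms by (induction n) (auto simp: plus_times)

lemma psum_star:
  assumes "\<And>n. w n \<in> carrier A"
  shows "star (psum w n) = psum (\<lambda>n. star (w n)) n"
  using assms by (induction n) (auto simp: star_plus)

lemma psum_single:
  assumes "\<And>n. w n \<in> carrier A" "\<And>n. n \<noteq> k \<Longrightarrow> w n = \<^bold>0" "n > k"
  shows "psum w n = w k"
proof -
  have "psum w n = (if k < n then w k else \<^bold>0)" for n
    using assms by (induction n) (auto simp: not_less less_Suc_eq)
  then show ?thesis using \<open>n > k\<close> by simp
qed

section \<open>Two polynomial identities with vanishing linear term\<close>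

text \<open>An expression is stored as a coefficient list over a fixed list of elements. Once all
  monomials have this form, a polynomial identity reduces to arithmetic with lists of
  numerals.\<close>

primrec lincomb :: "complex list \<Rightarrow> 'a list \<Rightarrow> 'a" where
  "lincomb cs [] = \<^bold>0"
| "lincomb cs (v # vs) = hd cs \<^bold>\<cdot> v \<^bold>+ lincomb (tl cs) vs"

lemma lincomb_closed [simp]: "set vs \<subseteq> carrier A \<Longrightarrow> lincomb cs vs \<in> carrier A"
  by (induction vs arbitrary: cs) auto

lemma lincomb_plus:
  assumes "set vs \<subseteq> carrier A" "length cs = length vs" "length ds = length vs"
  shows "lincomb cs vs \<^bold>+ lincomb ds vs = lincomb (map2 (+) cs ds) vs"
  using assms
proof (induction vs arbitrary: cs ds)
  case (Cons v vs)
  obtain c cs' d ds' where "cs = c # cs'" "ds = d # ds'"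
    using Cons.prems by (metis length_Suc_conv list.size(4) add_0_right add_Suc_right One_nat_def)
  then show ?case
    using Cons.prems Cons.IH[of cs' ds'] by (simp add: scale_plus_left plus_ac flip: Cons.IH)
qed simp

lemma lincomb_scale:
  assumes "set vs \<subseteq> carrier A" "length cs = length vs"
  shows "z \<^bold>\<cdot> lincomb cs vs = lincomb (map ((*) z) cs) vs"
  using assms
proof (induction vs arbitrary: cs)
  case (Cons v vs)
  obtain c cs' where "cs = c # cs'"
    using Cons.prems by (cases cs) auto
  then show ?case
    using Cons.prems Cons.IH[of cs'] by (simp add: scale_plus_right scale_scale)
qed simp

text \<open>The polynomial \<open>3 x\<^sup>2 - 2 x\<^sup>3\<close> fixes 0 and 1 and has derivative
  zero at both. As \<open>y\<close> commutes with \<open>q\<close>, the terms \<open>q y\<close>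
  therefore cancel, and the remainder is at least quadratic in \<open>y\<close>.\<close>

lemma step_projection:
  assumes "q \<in> carrier A" "y \<in> carrier A" "q \<^bold>* q = q" "y \<^bold>* q = q \<^bold>* y"
  defines "x \<equiv> q \<^bold>+ y"
  shows "3 \<^bold>\<cdot> (x \<^bold>* x) \<^bold>+ (-2) \<^bold>\<cdot> (x \<^bold>* (x \<^bold>* x))
    = q \<^bold>+ (3 \<^bold>\<cdot> (y \<^bold>* y) \<^bold>+ ((-6) \<^bold>\<cdot> (q \<^bold>* (y \<^bold>* y)) \<^bold>+ (-2) \<^bold>\<cdot> (y \<^bold>* (y \<^bold>* y))))"
proof -
  note c = assms(1,2)
  have yq: "y \<^bold>* (q \<^bold>* w) = q \<^bold>* (y \<^bold>* w)" if "w \<in> carrier A" for w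
    using c that assms(4) times_assoc by metis
  have qq: "q \<^bold>* (q \<^bold>* w) = q \<^bold>* w" if "w \<in> carrier A" for w
    using c that assms(3) times_assoc by metis
  have xx: "x \<^bold>* x = q \<^bold>+ (q \<^bold>* y \<^bold>+ (q \<^bold>* y \<^bold>+ y \<^bold>* y))"
    using c assms(3,4) by (simp add: x_def times_plus plus_times plus_assoc)
  have xxx: "x \<^bold>* (x \<^bold>* x) = (q \<^bold>+ (q \<^bold>* y \<^bold>+ (q \<^bold>* y \<^bold>+ q \<^bold>* (y \<^bold>* y)))) \<^bold>+
     (q \<^bold>* y \<^bold>+ (q \<^bold>* (y \<^bold>* y) \<^bold>+ (q \<^bold>* (y \<^bold>* y) \<^bold>+ y \<^bold>* (y \<^bold>* y))))"
    unfolding xx using c assms(3,4) yq qq by (simp add: x_def times_plus plus_times plus_assoc)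
  define vs where "vs = [q, q \<^bold>* y, q \<^bold>* (y \<^bold>* y), y \<^bold>* y, y \<^bold>* (y \<^bold>* y)]"
  have vs: "set vs \<subseteq> carrier A" "length vs = 5"
    using c by (simp_all add: vs_def)
  have L: "q = lincomb [1,0,0,0,0] vs" "q \<^bold>* y = lincomb [0,1,0,0,0] vs"
    "q \<^bold>* (y \<^bold>* y) = lincomb [0,0,1,0,0] vs"
    "y \<^bold>* y = lincomb [0,0,0,1,0] vs" "y \<^bold>* (y \<^bold>* y) = lincomb [0,0,0,0,1] vs"
    using c by (simp_all add: vs_def)
  \<comment> \<open>Longer monomials are replaced first, because the shorter ones occur inside
    them.\<close>
  show ?thesis
    unfolding xxx unfolding xx unfolding L(3,5) unfolding L(2,4)
    by (subst (1 2 3) L(1)) (simp add: lincomb_plus lincomb_scale vs)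
qed

text \<open>One step of the Newton-Schulz iteration, \<open>3/2 V - 1/2 V\<^sup>3\<close>, in the
  corner with unit \<open>p\<close>. Its derivative vanishes at \<open>p\<close>, so the terms
  linear in \<open>y\<close> cancel.\<close>

lemma step_unit:
  assumes "p \<in> carrier A" "y \<in> carrier A" "p \<^bold>* p = p" "y \<^bold>* p = y" "p \<^bold>* y = y"
  defines "V \<equiv> p \<^bold>+ y"
  shows "(3/2) \<^bold>\<cdot> V \<^bold>+ (-1/2) \<^bold>\<cdot> (V \<^bold>* (V \<^bold>* V))
    = p \<^bold>+ ((-3/2) \<^bold>\<cdot> (y \<^bold>* y) \<^bold>+ (-1/2) \<^bold>\<cdot> (y \<^bold>* (y \<^bold>* y)))"
proof -
  note c = assms(1,2)
  have py: "p \<^bold>* (y \<^bold>* w) = y \<^bold>* w" "y \<^bold>* (p \<^bold>* w) = y \<^bold>* w" "p \<^bold>* (p \<^bold>* w) = p \<^bold>* w"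
    if "w \<in> carrier A" for w
    using c that assms(3,4,5) times_assoc by metis+
  have VV: "V \<^bold>* V = p \<^bold>+ (y \<^bold>+ (y \<^bold>+ y \<^bold>* y))"
    using c assms(3,4,5) by (simp add: V_def times_plus plus_times plus_assoc)
  have VVV: "V \<^bold>* (V \<^bold>* V) = (p \<^bold>+ (y \<^bold>+ (y \<^bold>+ y \<^bold>* y))) \<^bold>+
     (y \<^bold>+ (y \<^bold>* y \<^bold>+ (y \<^bold>* y \<^bold>+ y \<^bold>* (y \<^bold>* y))))"
    unfolding VV using c assms(3,4,5) py by (simp add: V_def times_plus plus_times plus_assoc)
  define vs where "vs = [p, y, y \<^bold>* y, y \<^bold>* (y \<^bold>* y)]"
  have vs: "set vs \<subseteq> carrier A" "length vs = 4"
    using c by (simp_all add: vs_def)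
  have L: "p = lincomb [1,0,0,0] vs" "y = lincomb [0,1,0,0] vs"
    "y \<^bold>* y = lincomb [0,0,1,0] vs" "y \<^bold>* (y \<^bold>* y) = lincomb [0,0,0,1] vs"
    using c by (simp_all add: vs_def)
  show ?thesis
    unfolding VVV unfolding V_def unfolding L(4) unfolding L(3)
    by (subst (1 2 3) L(1), subst (1 2 3 4) L(2)) (simp add: lincomb_plus lincomb_scale vs)
qed

lemma dist_plus_left:
  assumes "a \<in> carrier A" "y \<in> carrier A"
  shows "dist_el A (a \<^bold>+ y) a = nrm y"
  using assms by (simp add: dist_el_def plus_minus_cancel)

lemma norm_lincomb2:
  assumes "a \<in> carrier A" "b \<in> carrier A"
  shows "nrm (\<alpha> \<^bold>\<cdot> a \<^bold>+ \<beta> \<^bold>\<cdot> b) \<le> cmod \<alpha> * nrm a + cmod \<beta> * nrm b"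
  using norm_triangle[of "\<alpha> \<^bold>\<cdot> a" "\<beta> \<^bold>\<cdot> b"] assms by (simp add: norm_scale)

lemma norm_lincomb3:
  assumes "a \<in> carrier A" "b \<in> carrier A" "d \<in> carrier A"
  shows "nrm (\<alpha> \<^bold>\<cdot> a \<^bold>+ (\<beta> \<^bold>\<cdot> b \<^bold>+ \<gamma> \<^bold>\<cdot> d)) \<le> cmod \<alpha> * nrm a + (cmod \<beta> * nrm b + cmod \<gamma> * nrm d)"
  using norm_triangle[of "\<alpha> \<^bold>\<cdot> a" "\<beta> \<^bold>\<cdot> b \<^bold>+ \<gamma> \<^bold>\<cdot> d"] norm_lincomb2[of b d \<beta> \<gamma>] assms
  by (simp add: norm_scale)

lemma norm_cube: "y \<in> carrier A \<Longrightarrow> nrm (y \<^bold>* (y \<^bold>* y)) \<le> nrm y * (nrm y * nrm y)"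
  by (meson norm_times norm_nonneg mult_left_mono order_trans closed)

lemma tends_halving:
  assumes "\<And>n. u n \<in> carrier A" "a \<in> carrier A" "\<And>n. dist_el A (u n) a \<le> K * (1/2)^n"
  shows "tends u a"
  by (rule tendsI_bound[where f = "\<lambda>n. K * (1/2)^n"])
    (use assms in \<open>auto intro!: tendsto_mult_right_zero LIMSEQ_power_zero\<close>)

end

section \<open>Recovering projections and partial isometries inside a closed subalgebra\<close>

locale cstar_sub = cstar_algebra +
  fixes S
  assumes sub: "cstar_subalgebra A S"
begin

lemma sub_carrier: "a \<in> S \<Longrightarrow> a \<in> carrier A"
  and sub_zero [simp]: "\<^bold>0 \<in> S"
  and sub_plus [simp]: "a \<in> S \<Longrightarrow> b \<in> S \<Longrightarrow> a \<^bold>+ b \<in> S"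
  and sub_scale [simp]: "a \<in> S \<Longrightarrow> z \<^bold>\<cdot> a \<in> S"
  and sub_times [simp]: "a \<in> S \<Longrightarrow> b \<in> S \<Longrightarrow> a \<^bold>* b \<in> S"
  and sub_star [simp]: "a \<in> S \<Longrightarrow> star a \<in> S"
  using sub unfolding cstar_subalgebra_def by auto

lemma sub_tends: "tends u a \<Longrightarrow> (\<And>n. u n \<in> S) \<Longrightarrow> a \<in> S"
  using sub unfolding cstar_subalgebra_def tends_def by blast

lemma sub_psum: "(\<And>n. n < k \<Longrightarrow> w n \<in> S) \<Longrightarrow> psum w k \<in> S"
  by (induction k) auto

text \<open>With \<open>y = x - q\<close>, one step of \<open>T\<close> has error at most
  \<open>9 (nrm y)\<^sup>2 + 2 (nrm y)\<^sup>3\<close>, which is at most half of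
  \<open>nrm y\<close> when \<open>nrm y \<le> 1/20\<close>. The iterates stay in the possibly
  nonunital \<open>S\<close> because \<open>T\<close> has no constant term, and they converge to
  \<open>q\<close>.\<close>

lemma near_projection:
  assumes q: "q \<in> carrier A" "star q = q" "q \<^bold>* q = q"
    and x: "x \<in> S" "x \<^bold>* q = q \<^bold>* x" "dist_el A x q \<le> 1/20"
  shows "q \<in> S"
proof -
  define T where "T x = 3 \<^bold>\<cdot> (x \<^bold>* x) \<^bold>+ (-2) \<^bold>\<cdot> (x \<^bold>* (x \<^bold>* x))" for x
  define u where "u n = (T ^^ n) x" for n
  have q1: "nrm q \<le> 1"
    using norm_projection_le q by simp
  have step: "T x \<in> S \<and> T x \<^bold>* q = q \<^bold>* T x \<and> dist_el A (T x) q \<le> dist_el A x q / 2 \<and> dist_el A (T x) q \<le> 1/20"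
    if x: "x \<in> S" "x \<^bold>* q = q \<^bold>* x" "dist_el A x q \<le> 1/20" for x
  proof -
    have xc: "x \<in> carrier A" using x sub_carrier by simp
    define y where "y = x \<^bold>+ (-1) \<^bold>\<cdot> q"
    have y: "y \<in> carrier A" "y \<^bold>* q = q \<^bold>* y" "q \<^bold>+ y = x" "nrm y = dist_el A x q"
      using q xc x by (simp_all add: y_def times_plus plus_times scale_times times_scale
          minus_plus_cancel dist_el_def)
    have T: "T x = q \<^bold>+ (3 \<^bold>\<cdot> (y \<^bold>* y) \<^bold>+ ((-6) \<^bold>\<cdot> (q \<^bold>* (y \<^bold>* y)) \<^bold>+ (-2) \<^bold>\<cdot> (y \<^bold>* (y \<^bold>* y))))"
      unfolding T_def using step_projection[of q y] q y by simp
    have yy: "nrm (y \<^bold>* y) \<le> nrm y * nrm y"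
      using norm_times[OF y(1) y(1)] .
    moreover have "nrm (q \<^bold>* (y \<^bold>* y)) \<le> nrm y * nrm y"
      using norm_times[OF q(1) times_closed[OF y(1) y(1)]] yy
        mult_right_mono[OF q1 norm_nonneg[OF times_closed[OF y(1) y(1)]]] by linarith
    moreover have "nrm (y \<^bold>* (y \<^bold>* y)) \<le> nrm y * (nrm y * nrm y)"
      using norm_cube[OF y(1)] .
    ultimately have "dist_el A (T x) q \<le> 3 * (nrm y * nrm y) + (6 * (nrm y * nrm y) + 2 * (nrm y * (nrm y * nrm y)))"
      using norm_lincomb3[of "y \<^bold>* y" "q \<^bold>* (y \<^bold>* y)" "y \<^bold>* (y \<^bold>* y)" 3 "-6" "-2"] q(1) y(1)
      unfolding T by (subst dist_plus_left) auto
    also have "\<dots> = nrm y * (9 * nrm y + 2 * (nrm y * nrm y))"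
      by (simp add: algebra_simps)
    also have "\<dots> \<le> nrm y * (1/2)"
    proof (rule mult_left_mono)
      have "nrm y \<le> 1/20" using y x by simp
      moreover have "nrm y * nrm y \<le> 1/20 * (1/20)"
        by (rule mult_mono) (use \<open>nrm y \<le> 1/20\<close> y(1) in auto)
      ultimately show "9 * nrm y + 2 * (nrm y * nrm y) \<le> 1/2" by simp
    qed (use y(1) in simp)
    finally have "dist_el A (T x) q \<le> dist_el A x q / 2" using y by simp
    moreover have "T x \<^bold>* q = q \<^bold>* T x"
    proof -
      have "x \<^bold>* (x \<^bold>* q) = q \<^bold>* (x \<^bold>* x)" "x \<^bold>* (x \<^bold>* (x \<^bold>* q)) = q \<^bold>* (x \<^bold>* (x \<^bold>* x))"
        using x xc q times_assoc[of q x x] times_assoc[of x q x] times_assoc[of x q "x \<^bold>* x"]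
          times_assoc[of q x "x \<^bold>* x"] by simp_all
      then show ?thesis
        using xc q by (simp add: T_def times_plus plus_times times_scale scale_times times_assoc)
    qed
    ultimately show ?thesis
      using x by (auto simp: T_def)
  qed
  have u: "u n \<in> S \<and> u n \<^bold>* q = q \<^bold>* u n \<and> dist_el A (u n) q \<le> 1/20 * (1/2)^n \<and> dist_el A (u n) q \<le> 1/20" for n
  proof (induction n)
    case 0
    then show ?case using x by (simp add: u_def)
  next
    case (Suc n)
    then show ?case using step[of "u n"] by (auto simp: u_def)
  qed
  have "tends u q"
    by (rule tends_halving[where K = "1/20"]) (use u q sub_carrier in auto)
  then show ?thesis using sub_tends u by blast
qed

text \<open>This extracts the polar part of \<open>e V\<close>, where \<open>V = p + z\<close>,
  without functional calculus. As \<open>star e\<close> times \<open>e\<close> is \<open>p\<close>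
  and \<open>z\<close> is self-adjoint, the product of \<open>e V\<close>, its adjoint and
  \<open>e V\<close> is \<open>e V\<^sup>3\<close>. So the Newton-Schulz step can be carried out on
  elements of \<open>S\<close>: it replaces \<open>z\<close> by \<open>T z\<close>, of at most half
  the norm.\<close>

lemma near_partial_isometry:
  assumes e: "e \<in> carrier A" "p \<in> carrier A" "star e \<^bold>* e = p" "star p = p" "p \<^bold>* p = p" "e \<^bold>* p = e"
    and z: "z \<in> carrier A" "star z = z" "p \<^bold>* z = z" "z \<^bold>* p = z" "nrm z \<le> 1/4"
    and S: "e \<^bold>+ e \<^bold>* z \<in> S"
  shows "e \<in> S"
proof -
  define T where "T y = (-3/2) \<^bold>\<cdot> (y \<^bold>* y) \<^bold>+ (-1/2) \<^bold>\<cdot> (y \<^bold>* (y \<^bold>* y))" for y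
  define u where "u n = (T ^^ n) z" for n
  define P where "P y \<longleftrightarrow> y \<in> carrier A \<and> star y = y \<and> p \<^bold>* y = y \<and> y \<^bold>* p = y \<and> nrm y \<le> 1/4 \<and> e \<^bold>+ e \<^bold>* y \<in> S" for y
  have step: "P (T y) \<and> nrm (T y) \<le> nrm y / 2" if "P y" for y
  proof -
    have y: "y \<in> carrier A" "star y = y" "p \<^bold>* y = y" "y \<^bold>* p = y" "nrm y \<le> 1/4" "e \<^bold>+ e \<^bold>* y \<in> S"
      using that by (auto simp: P_def)
    define V where "V = p \<^bold>+ y"
    have V: "V \<in> carrier A" "star V = V" "p \<^bold>* V = V" "V \<^bold>* p = V" "e \<^bold>* V \<in> S"
      using y e by (auto simp: V_def star_plus plus_times times_plus)
    have "star (e \<^bold>* V) \<^bold>* (e \<^bold>* V) = V \<^bold>* V"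
      using V e times_assoc[of "star e" e V] by (simp add: star_times times_assoc)
    then have "(e \<^bold>* V) \<^bold>* (star (e \<^bold>* V) \<^bold>* (e \<^bold>* V)) = e \<^bold>* (V \<^bold>* (V \<^bold>* V))"
      using V e by (simp add: times_assoc)
    moreover have "(e \<^bold>* V) \<^bold>* (star (e \<^bold>* V) \<^bold>* (e \<^bold>* V)) \<in> S"
      using V by simp
    ultimately have "(3/2) \<^bold>\<cdot> (e \<^bold>* V) \<^bold>+ (-1/2) \<^bold>\<cdot> (e \<^bold>* (V \<^bold>* (V \<^bold>* V))) \<in> S"
      using V by simp
    moreover have "(3/2) \<^bold>\<cdot> (e \<^bold>* V) \<^bold>+ (-1/2) \<^bold>\<cdot> (e \<^bold>* (V \<^bold>* (V \<^bold>* V))) = e \<^bold>* ((3/2) \<^bold>\<cdot> V \<^bold>+ (-1/2) \<^bold>\<cdot> (V \<^bold>* (V \<^bold>* V)))"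
      using V e by (simp add: times_plus times_scale)
    moreover have "(3/2) \<^bold>\<cdot> V \<^bold>+ (-1/2) \<^bold>\<cdot> (V \<^bold>* (V \<^bold>* V)) = p \<^bold>+ T y"
      unfolding V_def T_def using e y by (intro step_unit) auto
    ultimately have "e \<^bold>+ e \<^bold>* T y \<in> S"
      using e y by (simp add: T_def times_plus)
    moreover have "star (T y) = T y" "p \<^bold>* T y = T y" "T y \<^bold>* p = T y"
      using y e times_assoc[of p y y] times_assoc[of p y "y \<^bold>* y"]
      by (auto simp: T_def star_plus star_scale star_times times_plus plus_times
          times_scale scale_times times_assoc)
    moreover have "nrm (T y) \<le> nrm y / 2"
    proof -
      have "nrm (T y) \<le> 3/2 * (nrm y * nrm y) + 1/2 * (nrm y * (nrm y * nrm y))"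
        unfolding T_def using y norm_cube[of y] norm_times[of y y]
          norm_lincomb2[of "y \<^bold>* y" "y \<^bold>* (y \<^bold>* y)" "-3/2" "-1/2"] by (simp add: norm_divide)
      also have "\<dots> = nrm y * (3/2 * nrm y + 1/2 * (nrm y * nrm y))"
        by (simp add: algebra_simps)
      also have "\<dots> \<le> nrm y * (1/2)"
      proof (rule mult_left_mono)
        have "nrm y * nrm y \<le> 1/4 * (1/4)"
          by (rule mult_mono) (use y in auto)
        then show "3/2 * nrm y + 1/2 * (nrm y * nrm y) \<le> 1/2" using y by simp
      qed (use y in auto)
      finally show ?thesis by simp
    qed
    moreover have "T y \<in> carrier A" using y by (simp add: T_def)
    ultimately show ?thesis
      using y norm_nonneg[of y] unfolding P_def by auto
  qed
  have u: "P (u n) \<and> nrm (u n) \<le> 1/4 * (1/2)^n" for n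
  proof (induction n)
    case 0
    then show ?case using z S by (simp add: u_def P_def)
  next
    case (Suc n)
    then show ?case using step[of "u n"] by (auto simp: u_def)
  qed
  have "tends (\<lambda>n. e \<^bold>+ e \<^bold>* u n) e"
  proof (rule tends_halving[where K = "nrm e * (1/4)"])
    fix n
    have "dist_el A (e \<^bold>+ e \<^bold>* u n) e = nrm (e \<^bold>* u n)"
      using u[of n] e by (subst dist_plus_left) (auto simp: P_def)
    also have "\<dots> \<le> nrm e * nrm (u n)"
      using norm_times u[of n] e by (simp add: P_def)
    also have "\<dots> \<le> nrm e * (1/4 * (1/2)^n)"
      using u[of n] e by (intro mult_left_mono) auto
    finally show "dist_el A (e \<^bold>+ e \<^bold>* u n) e \<le> nrm e * (1/4) * (1/2)^n" by simp
  qed (use u e in \<open>auto simp: P_def\<close>)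
  then show ?thesis
    by (rule sub_tends) (use u in \<open>auto simp: P_def\<close>)
qed

end

section \<open>A single element that generates commuting projections and the elements isolated by
  them\<close>

context cstar_algebra
begin

text \<open>The real part of the generator carries the projections with rapidly decaying weights,
  the imaginary part the elements \<open>u n\<close>, each of which is isolated by two of the projections.\<close>

lemma joint_generator:
  fixes q u p r :: "nat \<Rightarrow> 'a"
  assumes q: "\<And>n. q n \<in> carrier A" "\<And>n. star (q n) = q n" "\<And>n. q n \<^bold>* q n = q n"
      "\<And>m n. q m \<^bold>* q n = q n \<^bold>* q m"
    and u: "\<And>n. u n \<in> carrier A"
    and pr: "\<And>n. p n \<in> range q" "\<And>n. r n \<in> range q"
    and isol: "\<And>n. p n \<^bold>* u n \<^bold>* r n = u n"
      "\<And>m n. m \<noteq> n \<Longrightarrow> p n \<^bold>* u m \<^bold>* r n = \<^bold>0"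
      "\<And>m n. p n \<^bold>* star (u m) \<^bold>* r n = \<^bold>0"
  shows "\<exists>b\<in>carrier A. \<forall>S. cstar_subalgebra A S \<longrightarrow> b \<in> S \<longrightarrow> range q \<subseteq> S \<and> range u \<subseteq> S"
proof -
  have q1: "nrm (q n) \<le> 1" for n
    using norm_projection_le q by simp
  define w where "w n = complex_of_real ((1/40)^n) \<^bold>\<cdot> q n" for n
  have w: "w n \<in> carrier A" "nrm (w n) \<le> (1/40)^n" "star (w n) = w n" for n
    using q q1[of n] by (simp_all add: w_def norm_scale norm_power norm_divide star_scale power_divide divide_right_mono)
  define v where "v n = u n \<^bold>+ star (u n)" for n
  \<comment> \<open>No common bound on the \<open>u n\<close> is assumed, so the weights normalise
    them; the summand 1 keeps the denominator positive.\<close>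
  define a where "a n = (1/2)^n / (1 + nrm (v n))" for n
  have v: "v n \<in> carrier A" "star (v n) = v n" "1 + nrm (v n) > 0" for n
    using u[of n] norm_nonneg[of "v n"] by (auto simp: v_def star_plus star_star plus_commute add_pos_nonneg)
  have a: "a n > 0" "a n * nrm (v n) \<le> (1/2)^n" for n
  proof -
    show "a n > 0" using v(3)[of n] by (simp add: a_def)
    have "a n * nrm (v n) = (1/2)^n * (nrm (v n) / (1 + nrm (v n)))"
      by (simp add: a_def)
    also have "\<dots> \<le> (1/2)^n * 1"
      using v[of n] by (intro mult_left_mono) (auto simp: divide_le_eq)
    finally show "a n * nrm (v n) \<le> (1/2)^n" by simp
  qed
  define t where "t n = complex_of_real (a n) \<^bold>\<cdot> v n" for n
  have t: "t n \<in> carrier A" "nrm (t n) \<le> (1/2)^n" "star (t n) = t n" for n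
    using v a[of n] by (simp_all add: t_def norm_scale star_scale)
  have "summable (\<lambda>n. nrm (w n))"
    by (rule summable_comparison_test'[OF summable_geometric[of "1/40::real"], of 0]) (use w in auto)
  then obtain d where d: "tends (psum w) d"
    using psum_converges w by blast
  have "summable (\<lambda>n. nrm (t n))"
    by (rule summable_comparison_test'[OF summable_geometric[of "1/2::real"], of 0]) (use t in auto)
  then obtain h where h: "tends (psum t) h"
    using psum_converges t by blast
  have c: "d \<in> carrier A" "h \<in> carrier A"
    using d h by (auto simp: tends_def)
  have sd: "star d = d" and sh: "star h = h"
    using tends_unique[OF tends_star[OF d], of d] tends_unique[OF tends_star[OF h], of h] d h
    by (simp_all add: psum_star w t)
  have dq: "d \<^bold>* q n = q n \<^bold>* d" for n
  proof -
    have "psum w k \<^bold>* q n = q n \<^bold>* psum w k" for k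
      using w q by (simp add: psum_times_left psum_times_right w_def scale_times times_scale)
    then show ?thesis
      using tends_unique[OF tends_times_right[OF d q(1)[of n]]] tends_times_left[OF d q(1)[of n]]
      by simp
  qed
  \<comment> \<open>Isolation kills every term of the series except the \<open>n\<close>-th, so the
    compressed partial sums are eventually constant.\<close>
  have ph: "p n \<^bold>* h \<^bold>* r n = complex_of_real (a n) \<^bold>\<cdot> u n" for n
  proof -
    have c: "p n \<in> carrier A" "r n \<in> carrier A"
      using pr[of n] q(1) by (metis rangeE)+
    have *: "p n \<^bold>* t m \<^bold>* r n = (if m = n then complex_of_real (a n) \<^bold>\<cdot> u n else \<^bold>0)" for m
      using c u isol by (simp add: t_def v_def times_plus plus_times times_scale scale_times)
    have "tends (\<lambda>k. p n \<^bold>* psum t k \<^bold>* r n) (p n \<^bold>* h \<^bold>* r n)"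
      using tends_times_left tends_times_right h c by simp
    moreover have "p n \<^bold>* psum t k \<^bold>* r n = complex_of_real (a n) \<^bold>\<cdot> u n" if "k \<ge> Suc n" for k
      using psum_single[of "\<lambda>m. p n \<^bold>* t m \<^bold>* r n" n k] that c t u
      by (simp add: psum_times_left psum_times_right *)
    ultimately show ?thesis
      using tends_eventually[of "\<lambda>k. p n \<^bold>* psum t k \<^bold>* r n" _ _ "Suc n"] u by simp
  qed
  have tail: "dist_el A d (psum w (Suc n)) \<le> (1/40)^n / 20" for n
  proof (rule tends_le[OF d])
    fix k assume k: "k \<ge> Suc n"
    have "dist_el A (psum w k) (psum w (Suc n)) \<le> (\<Sum>i=Suc n..<k. nrm (w i))"
      using dist_psum[of w "Suc n" k] w(1) k by blast
    also have "\<dots> \<le> (\<Sum>i=Suc n..<k. (1/40)^i)"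
      using w by (intro sum_mono) auto
    finally have 1: "dist_el A (psum w k) (psum w (Suc n)) \<le> (\<Sum>i=Suc n..<k. (1/40)^i)" .
    \<comment> \<open>Adding the value of the remaining geometric tail makes the formula exact, so
      that it passes through the induction on \<open>k\<close>.\<close>
    have "(\<Sum>i=Suc n..<k. (1/40)^i) + (1/40)^k * (40/39) = ((1/40)^n / 39 :: real)"
      using k
    proof (induction k rule: dec_induct)
      case (step k)
      then show ?case by simp
    qed simp
    then have "(\<Sum>i=Suc n..<k. (1/40)^i) \<le> ((1/40)^n / 20 :: real)"
      using zero_le_power[of "1/40::real" k] zero_le_power[of "1/40::real" n] by linarith
    with 1 show "dist_el A (psum w k) (psum w (Suc n)) \<le> (1/40)^n / 20" by linarith
  qed (use w in auto)
  define b where "b = d \<^bold>+ \<i> \<^bold>\<cdot> h"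
  show ?thesis
  proof (intro bexI[of _ b] allI impI)
    show "b \<in> carrier A" using c by (simp add: b_def)
    fix S assume S: "cstar_subalgebra A S" "b \<in> S"
    interpret cstar_sub A S by unfold_locales (rule S)
    have sb: "star b = d \<^bold>+ (-\<i>) \<^bold>\<cdot> h"
      using c sd sh by (simp add: b_def star_plus star_scale)
    have "b \<^bold>+ star b = (d \<^bold>+ d) \<^bold>+ (\<i> \<^bold>\<cdot> h \<^bold>+ (-\<i>) \<^bold>\<cdot> h)"
      unfolding sb unfolding b_def using c by (simp add: plus_ac)
    also have "\<dots> = 2 \<^bold>\<cdot> d"
      using c scale_plus_left[of d 1 1] scale_plus_left[of h \<i> "-\<i>", symmetric] by simp
    finally have "b \<^bold>+ star b = 2 \<^bold>\<cdot> d" .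
    then have dS: "d \<in> S"
      using c sub_scale[OF sub_plus[OF S(2) sub_star[OF S(2)]], of "1/2"] by (simp add: scale_scale)
    have "b \<^bold>+ (-1) \<^bold>\<cdot> d = \<i> \<^bold>\<cdot> h"
      using c by (simp add: b_def plus_minus_cancel)
    then have hS: "h \<in> S"
      using c sub_scale[OF sub_plus[OF S(2) sub_scale[OF dS, of "-1"]], of "-\<i>"] by (simp add: scale_scale)
    \<comment> \<open>The projections are recovered one after another: once those before
      \<open>n\<close> are in \<open>S\<close>, their terms are subtracted from \<open>d\<close>,
      and rescaling leaves \<open>q n\<close> with error at most 1/20.\<close>
    have qS: "q n \<in> S" for n
    proof (induction n rule: less_induct)
      case (less n)
      define x where "x = complex_of_real (40^n) \<^bold>\<cdot> (d \<^bold>+ (-1) \<^bold>\<cdot> psum w n)"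
      show ?case
      proof (rule near_projection)
        have "psum w n \<in> S"
          using less by (intro sub_psum) (auto simp: w_def)
        then show "x \<in> S" using dS by (simp add: x_def)
        show "x \<^bold>* q n = q n \<^bold>* x"
          using w q c dq
          by (simp add: x_def psum_times_left psum_times_right w_def scale_times times_scale
              times_plus plus_times)
        have "x \<^bold>+ (-1) \<^bold>\<cdot> q n = complex_of_real (40^n) \<^bold>\<cdot> (d \<^bold>+ (-1) \<^bold>\<cdot> psum w (Suc n))"
          using w q c
          by (simp add: x_def w_def scale_plus_right scale_scale plus_assoc flip: of_real_mult power_mult_distrib)
        then show "dist_el A x (q n) \<le> 1/20"
          using tail[of n] w c q unfolding dist_el_def
          by (simp add: norm_scale norm_power field_simps)
      qed (use q in auto)
    qed
    moreover have "u n \<in> S" for n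
    proof -
      have "p n \<in> S" "r n \<in> S" using qS pr[of n] by auto
      then have "complex_of_real (a n) \<^bold>\<cdot> u n \<in> S" 
        using hS unfolding ph[symmetric] by simp
      then show ?thesis
        using sub_scale[of "complex_of_real (a n) \<^bold>\<cdot> u n" "complex_of_real (1 / a n)"] a[of n] u
        by (simp add: scale_scale)
    qed
    ultimately show "range q \<subseteq> S \<and> range u \<subseteq> S" by auto
  qed
qed

end

section \<open>Systems of matrix units\<close>

text \<open>The indices form a tree: \<open>par\<close> leads from level \<open>i + 1\<close> to the
  parent at level \<open>i\<close>, and \<open>lst\<close> singles out one child of each parent.
  Diagonal units lie below those of their parents; off-diagonal units of level \<open>i\<close> are
  tied to level \<open>i + 1\<close> through the last children alone, by \<open>e_lst\<close>. The
  bound 1/4 is the radius in \<open>near_partial_isometry\<close>.\<close>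

locale matrix_unit_system = cstar_algebra +
  fixes M :: "nat \<Rightarrow> nat" and e :: "nat \<Rightarrow> nat \<Rightarrow> nat \<Rightarrow> 'a"
    and par lst :: "nat \<Rightarrow> nat \<Rightarrow> nat" and F :: "nat \<Rightarrow> 'a"
  assumes M_0: "M 0 = 1"
    and e_closed: "\<lbrakk>r < M i; s < M i\<rbrakk> \<Longrightarrow> e i r s \<in> carrier A"
    and e_mult: "\<lbrakk>r < M i; s < M i; s' < M i; t < M i\<rbrakk> \<Longrightarrow>
      e i r s \<^bold>* e i s' t = (if s = s' then e i r t else \<^bold>0)"
    and e_star: "\<lbrakk>r < M i; s < M i\<rbrakk> \<Longrightarrow> star (e i r s) = e i s r"
    and par_less: "s < M (Suc i) \<Longrightarrow> par i s < M i"
    and lst_less: "r < M i \<Longrightarrow> lst i r < M (Suc i)"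
    and par_lst: "r < M i \<Longrightarrow> par i (lst i r) = r"
    and e_par: "s < M (Suc i) \<Longrightarrow> e i (par i s) (par i s) \<^bold>* e (Suc i) s s = e (Suc i) s s"
    and e_lst: "\<lbrakk>r < M i; s < M i\<rbrakk> \<Longrightarrow>
      e i r s \<^bold>* e (Suc i) (lst i s) (lst i s) = e (Suc i) (lst i r) (lst i s)"
    and F_closed: "F j \<in> carrier A"
    and F_star: "star (F j) = F j"
    and F_norm: "nrm (F j) \<le> 1/4"
    and F_commute: "r < M i \<Longrightarrow> e i r r \<^bold>* F j = F j \<^bold>* e i r r"
    and F_lst: "r < M j \<Longrightarrow>
      \<exists>z. F j \<^bold>* e (Suc j) (lst j r) (lst j r) = z \<^bold>\<cdot> e (Suc j) (lst j r) (lst j r)"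
begin

text \<open>Iterating \<open>par\<close> from level \<open>j\<close> to level \<open>i\<close> gives
  \<open>t\<close>; taking adjoints turns the left relation into the right one. The arbitrary factor
  \<open>a\<close> makes both usable inside longer products.\<close>

lemma ancestor:
  assumes "i \<le> j" "s < M j"
  shows "\<exists>t<M i. \<forall>a\<in>carrier A. e i t t \<^bold>* (e j s s \<^bold>* a) = e j s s \<^bold>* a \<and> a \<^bold>* e j s s \<^bold>* e i t t = a \<^bold>* e j s s"
proof -
  have "\<exists>t<M i. e i t t \<^bold>* e j s s = e j s s"
    using assms
  proof (induction j arbitrary: s rule: dec_induct)
    case base
    then show ?case by (intro exI[of _ s]) (simp add: e_mult)
  next
    case (step j)
    let ?a = "par j s"
    obtain t where t: "t < M i" "e i t t \<^bold>* e j ?a ?a = e j ?a ?a"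
      using step par_less by blast
    have "e i t t \<^bold>* e (Suc j) s s = e i t t \<^bold>* (e j ?a ?a \<^bold>* e (Suc j) s s)"
      using e_par step by simp
    also have "\<dots> = e j ?a ?a \<^bold>* e (Suc j) s s"
      using t step par_less e_closed by (simp flip: times_assoc)
    finally show ?case using t e_par step by auto
  qed
  then obtain t where t: "t < M i" "e i t t \<^bold>* e j s s = e j s s" by blast
  have "e j s s \<^bold>* e i t t = star (e i t t \<^bold>* e j s s)"
    using t(1) assms(2) by (simp add: star_times e_closed e_star)
  then have "e j s s \<^bold>* e i t t = e j s s"
    using t assms by (simp add: e_star)
  with t show ?thesis
    using assms e_closed by (intro exI[of _ t]) (auto simp: times_assoc simp flip: times_assoc[of "e i t t"])
qed

lemma e_mult_left:
  "\<lbrakk>r < M i; s < M i; s' < M i; t < M i; a \<in> carrier A\<rbrakk> \<Longrightarrow>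
      e i r s \<^bold>* (e i s' t \<^bold>* a) = (if s = s' then e i r t \<^bold>* a else \<^bold>0)"
  by (simp add: e_closed e_mult flip: times_assoc)

text \<open>Describes a corner in the sense of operator algebras. The level is shifted because level
  0 has a single index, so pairs of siblings start at level 1.\<close>

definition sandwich :: "nat \<Rightarrow> nat \<Rightarrow> nat \<Rightarrow> 'a \<Rightarrow> bool" where
  "sandwich j r s w \<longleftrightarrow> w \<in> carrier A \<and> e (Suc j) r r \<^bold>* w = w \<and> w \<^bold>* e (Suc j) s s = w"

text \<open>Of two pairs of siblings at different levels, the pair at the finer level lies below a single
  index of the coarser level.\<close>

lemma sandwich_other_level:
  assumes w: "sandwich j' r' s' w"
    and rs: "r < M (Suc j)" "s < M (Suc j)" "r \<noteq> s" "par j r = par j s"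
    and rs': "r' < M (Suc j')" "s' < M (Suc j')" "r' \<noteq> s'" "par j' r' = par j' s'"
    and "j \<noteq> j'"
  shows "e (Suc j) r r \<^bold>* w \<^bold>* e (Suc j) s s = \<^bold>0"
proof (cases "j < j'")
  \<comment> \<open>Here \<open>w\<close> lies below one index \<open>t\<close> of level
    \<open>Suc j\<close>; since \<open>r\<close> and \<open>s\<close> differ, one of them differs
    from \<open>t\<close>.\<close>
  case True
  define a where "a = par j' r'"
  have a: "a < M j'" using par_less rs' by (simp add: a_def)
  obtain t where t: "t < M (Suc j)" "\<And>b. b \<in> carrier A \<Longrightarrow> e (Suc j) t t \<^bold>* (e j' a a \<^bold>* b) = e j' a a \<^bold>* b"
     "\<And>b. b \<in> carrier A \<Longrightarrow> b \<^bold>* e j' a a \<^bold>* e (Suc j) t t = b \<^bold>* e j' a a"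
    using ancestor[of "Suc j" j' a] a True by (auto simp: Suc_le_eq)
  have wc: "w \<in> carrier A" using w by (simp add: sandwich_def)
  note c = e_closed[OF a a] e_closed[OF t(1) t(1)] e_closed[OF rs(1,1)] e_closed[OF rs(2,2)]
    e_closed[OF rs'(1,1)] e_closed[OF rs'(2,2)] wc
  have er: "e j' a a \<^bold>* e (Suc j') r' r' = e (Suc j') r' r'"
    using e_par[OF rs'(1)] by (simp add: a_def)
  have "star (e j' a a \<^bold>* e (Suc j') s' s') = star (e (Suc j') s' s')"
    using e_par[OF rs'(2)] rs'(4) by (simp add: a_def)
  then have es: "e (Suc j') s' s' \<^bold>* e j' a a = e (Suc j') s' s'"
    using c a rs'(2) by (simp add: star_times e_star)
  have "e j' a a \<^bold>* w = w" "w \<^bold>* e j' a a = w"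
    using w c er es unfolding sandwich_def by (metis times_assoc)+
  then have tw: "e (Suc j) t t \<^bold>* w = w" "w \<^bold>* e (Suc j) t t = w"
    using t(2,3)[of w] wc by simp_all
  then have "e (Suc j) r r \<^bold>* w \<^bold>* e (Suc j) s s
      = e (Suc j) r r \<^bold>* (e (Suc j) t t \<^bold>* (w \<^bold>* (e (Suc j) t t \<^bold>* e (Suc j) s s)))"
    using c by (metis times_assoc times_closed)
  then show ?thesis
    using c t(1) rs by (auto simp: e_mult e_mult_left)
next
  \<comment> \<open>Now \<open>r\<close> and \<open>s\<close> lie below one index \<open>t\<close>
    of the coarser level \<open>Suc j'\<close>, and one of \<open>r'\<close> and \<open>s'\<close>
    differs from \<open>t\<close>.\<close>
  case False
  with \<open>j \<noteq> j'\<close> have "Suc j' \<le> j" by simp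
  define a where "a = par j r"
  have a: "a < M j" using par_less rs by (simp add: a_def)
  obtain t where t: "t < M (Suc j')" "\<And>b. b \<in> carrier A \<Longrightarrow> e (Suc j') t t \<^bold>* (e j a a \<^bold>* b) = e j a a \<^bold>* b"
     "\<And>b. b \<in> carrier A \<Longrightarrow> b \<^bold>* e j a a \<^bold>* e (Suc j') t t = b \<^bold>* e j a a"
    using ancestor[OF \<open>Suc j' \<le> j\<close> a] by blast
  have wc: "w \<in> carrier A" using w by (simp add: sandwich_def)
  note c = e_closed[OF a a] e_closed[OF t(1) t(1)] e_closed[OF rs(1,1)] e_closed[OF rs(2,2)]
    e_closed[OF rs'(1,1)] e_closed[OF rs'(2,2)] wc
  have "star (e j a a \<^bold>* e (Suc j) r r) = star (e (Suc j) r r)"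
    using e_par[OF rs(1)] by (simp add: a_def)
  then have er: "e (Suc j) r r \<^bold>* e j a a = e (Suc j) r r"
    using c a rs(1) by (simp add: star_times e_star)
  have es: "e j a a \<^bold>* e (Suc j) s s = e (Suc j) s s"
    using e_par[OF rs(2)] rs(4) by (simp add: a_def)
  have r: "e (Suc j) r r \<^bold>* e (Suc j') t t = e (Suc j) r r"
    using t(3)[of "e (Suc j) r r"] er c by simp
  have s: "e (Suc j') t t \<^bold>* e (Suc j) s s = e (Suc j) s s"
    using t(2)[of "e (Suc j) s s"] es c by simp
  have "e (Suc j) r r \<^bold>* w \<^bold>* e (Suc j) s s
      = (e (Suc j) r r \<^bold>* e (Suc j') t t) \<^bold>* (e (Suc j') r' r' \<^bold>* (w \<^bold>* e (Suc j') s' s'))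
        \<^bold>* (e (Suc j') t t \<^bold>* e (Suc j) s s)"
    using w r s by (simp add: sandwich_def)
  also have "\<dots> = e (Suc j) r r \<^bold>* (e (Suc j') t t \<^bold>* (e (Suc j') r' r' \<^bold>* (w \<^bold>*
     (e (Suc j') s' s' \<^bold>* (e (Suc j') t t \<^bold>* e (Suc j) s s)))))"
    using c by (simp add: times_assoc)
  also have "\<dots> = \<^bold>0"
    using c t(1) rs' by (auto simp: e_mult e_mult_left)
  finally show ?thesis .
qed

text \<open>\<open>joint_generator\<close> is applied to all diagonal units and to the edges
  \<open>v\<close>, which join each non-last index to its last sibling. From an edge,
  \<open>near_partial_isometry\<close> recovers the matrix unit and then the entry of
  \<open>F j\<close>; the remaining units follow by induction on the level.\<close>

lemma generator_exists:
  "\<exists>b\<in>carrier A. \<forall>S. cstar_subalgebra A S \<longrightarrow> b \<in> S \<longrightarrow>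
     (\<forall>i r s. r < M i \<longrightarrow> s < M i \<longrightarrow> e i r s \<in> S) \<and>
     (\<forall>j s. s < M (Suc j) \<longrightarrow> F j \<^bold>* e (Suc j) s s \<in> S)"
proof -
  define root where "root j s = lst j (par j s)" for j s
  define valid where "valid = (\<lambda>(j, s). s < M (Suc j) \<and> root j s \<noteq> s)"
  have root: "root j s < M (Suc j)" "par j (root j s) = par j s" if "s < M (Suc j)" for j s
    using that par_less lst_less par_lst by (auto simp: root_def)
  have root_root: "root j (root j s) = root j s" if "s < M (Suc j)" for j s
    using root[OF that] by (simp add: root_def)
  \<comment> \<open>Codes without a valid index get the projection zero, so that the family is
    indexed by all naturals.\<close>
  define q where "q n = (let (i, r) = prod_decode n in if r < M i then e i r r else \<^bold>0)" for n
  define P where "P = (\<lambda>i r. q (prod_encode (i, r)))"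
  have P: "P i r = (if r < M i then e i r r else \<^bold>0)" for i r
    by (simp add: P_def q_def)
  define v where "v = (\<lambda>(j, s). e (Suc j) (root j s) s \<^bold>+ e (Suc j) (root j s) s \<^bold>* F j)"
  have v: "v (j, s) \<in> carrier A" "sandwich j (root j s) s (v (j, s))"
    "sandwich j s (root j s) (star (v (j, s)))" if s: "s < M (Suc j)" for j s
  proof -
    note r = root[OF s] 
    note c = e_closed[OF r(1) r(1)] e_closed[OF r(1) s] e_closed[OF s r(1)] e_closed[OF s s]
    show 1: "v (j, s) \<in> carrier A" using c F_closed by (simp add: v_def)
    have "e (Suc j) (root j s) s \<^bold>* (F j \<^bold>* e (Suc j) s s) = e (Suc j) (root j s) s \<^bold>* F j"
      using c F_commute[OF s] s r F_closed by (simp add: e_mult_left flip: F_commute)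
    then show 2: "sandwich j (root j s) s (v (j, s))"
      using c 1 s r F_closed
      by (simp add: sandwich_def v_def times_plus plus_times e_mult e_mult_left times_assoc)
    have "star (e (Suc j) (root j s) (root j s) \<^bold>* v (j, s)) = star (v (j, s))"
      "star (v (j, s) \<^bold>* e (Suc j) s s) = star (v (j, s))"
      using 2 by (simp_all add: sandwich_def)
    then show "sandwich j s (root j s) (star (v (j, s)))"
      using 1 c s r by (simp add: sandwich_def star_times e_star)
  qed
  define u where "u n = (if valid (prod_decode n) then v (prod_decode n) else \<^bold>0)" for n
  \<comment> \<open>The index \<open>M (Suc j)\<close> is out of range and makes \<open>P\<close>
    zero. Thus \<open>p n\<close> and \<open>r n\<close> vanish at codes without an edge and still
    belong to the range of \<open>q\<close>.\<close>
  define p where "p n = (let (j, s) = prod_decode n in P (Suc j) (if valid (j, s) then root j s else M (Suc j)))" for n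
  define r where "r n = (let (j, s) = prod_decode n in P (Suc j) (if valid (j, s) then s else M (Suc j)))" for n
  have qc: "q n \<in> carrier A" "star (q n) = q n" "q n \<^bold>* q n = q n" for n
    by (auto simp: q_def split: prod.splits intro: e_closed simp: e_mult e_star)
  \<comment> \<open>Of two diagonal units, the one of the later level lies below the other or is
    orthogonal to it.\<close>
  have q_comm: "q m \<^bold>* q n = q n \<^bold>* q m" for m n
  proof -
    have *: "e i a a \<^bold>* e j b b = e j b b \<^bold>* e i a a" if ij: "i \<le> j" "a < M i" "b < M j" for i j a b
    proof -
      obtain t where t: "t < M i" "\<And>d. d \<in> carrier A \<Longrightarrow> e i t t \<^bold>* (e j b b \<^bold>* d) = e j b b \<^bold>* d"
        "\<And>d. d \<in> carrier A \<Longrightarrow> d \<^bold>* e j b b \<^bold>* e i t t = d \<^bold>* e j b b"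
        using ancestor[OF ij(1,3)] by blast
      note c = e_closed[OF that(2,2)] e_closed[OF that(3,3)] e_closed[OF t(1,1)]
      have tb: "e i t t \<^bold>* e j b b = e j b b"
        using t(2)[of "e j b b"] c ij by (simp add: e_mult)
      have 1: "e i a a \<^bold>* e j b b = (if a = t then e j b b else \<^bold>0)"
        using e_mult_left[OF ij(2,2) t(1,1) c(2)] ij t(1) by (simp add: tb split: if_splits)
      have "e j b b \<^bold>* e i a a = star (e i a a \<^bold>* e j b b)"
        using c ij by (simp add: star_times e_star)
      also have "\<dots> = e i a a \<^bold>* e j b b"
        unfolding 1 using ij by (simp add: e_star)
      finally show ?thesis by simp
    qed
    obtain i a j b where mn: "prod_decode m = (i, a)" "prod_decode n = (j, b)"
      by (metis surj_pair)
    show ?thesis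
      using *[of i j a b] *[of j i b a] mn e_closed
      by (auto simp: q_def intro: linorder_le_cases[of i j])
  qed
  have isol1: "p n \<^bold>* u n \<^bold>* r n = u n" for n
  proof -
    obtain j s where n: "prod_decode n = (j, s)" by (metis surj_pair)
    show ?thesis
      using v[of s j] root[of s j] qc by (auto simp: p_def u_def r_def n valid_def P sandwich_def)
  qed
  have other: "p n \<^bold>* w \<^bold>* r n = \<^bold>0"
    if "prod_decode n = (j, s)" "valid (j, s)" "sandwich j' a b w" "j \<noteq> j'"
       "a < M (Suc j')" "b < M (Suc j')" "a \<noteq> b" "par j' a = par j' b" for n j s j' a b w
    using sandwich_other_level[OF that(3), of "root j s" j s] that root
    by (auto simp: p_def r_def P valid_def)
  have same: "p n \<^bold>* w \<^bold>* r n = \<^bold>0"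
    if "prod_decode n = (j, s)" "valid (j, s)" "sandwich j a b w"
       "a < M (Suc j)" "b < M (Suc j)" "a \<noteq> root j s \<or> b \<noteq> s" for n j s a b w
  proof -
    have s: "s < M (Suc j)" using that by (simp add: valid_def)
    note c = e_closed[OF s s] e_closed[OF root(1)[OF s] root(1)[OF s]] e_closed[OF that(4,4)] e_closed[OF that(5,5)]
    have w: "w \<in> carrier A" "e (Suc j) a a \<^bold>* w = w" "w \<^bold>* e (Suc j) b b = w"
      using that by (auto simp: sandwich_def)
    have "p n \<^bold>* w \<^bold>* r n = e (Suc j) (root j s) (root j s) \<^bold>* (e (Suc j) a a \<^bold>* (w \<^bold>* (e (Suc j) b b \<^bold>* e (Suc j) s s)))"
      using that w c root(1)[OF s] s by (simp add: p_def r_def P flip: times_assoc)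
    also have "\<dots> = \<^bold>0"
      using c w that s root(1)[OF s] by (auto simp: e_mult e_mult_left)
    finally show ?thesis .
  qed
  have pr_zero: "p n = \<^bold>0" "r n = \<^bold>0" if "\<not> valid (prod_decode n)" for n
    using that by (auto simp: p_def r_def P split: prod.splits)
  have prc: "p n \<in> carrier A" "r n \<in> carrier A" for n
    using qc(1) by (auto simp: p_def r_def P_def split: prod.splits)
  have uc: "u n \<in> carrier A" for n
    using v by (auto simp: u_def valid_def split: prod.splits)
  have isol2: "p n \<^bold>* u m \<^bold>* r n = \<^bold>0" if "m \<noteq> n" for m n
  proof (cases "valid (prod_decode n) \<and> valid (prod_decode m)")
    case True
    obtain j s j' s' where n: "prod_decode n = (j, s)" "prod_decode m = (j', s')" by (metis surj_pair)
    then have ne: "(j, s) \<noteq> (j', s')" using that by (metis prod_decode_inverse)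
    have val: "valid (j, s)" "valid (j', s')" using True n by auto
    then have s': "s' < M (Suc j')" "root j' s' \<noteq> s'" by (auto simp: valid_def)
    have um: "u m = v (j', s')" using val n by (simp add: u_def)
    show ?thesis
    proof (cases "j = j'")
      case True
      then show ?thesis
        using same[OF n(1) val(1), of "root j' s'" s' "v (j', s')"] v(2)[OF s'(1)] root[OF s'(1)] s' ne
        by (auto simp: um)
    next
      case False
      then show ?thesis
        using other[OF n(1) val(1) v(2)[OF s'(1)]] root[OF s'(1)] s' by (simp add: um)
    qed
  next
    case False
    then have "u m = \<^bold>0 \<or> p n = \<^bold>0"
      using pr_zero by (auto simp: u_def)
    then show ?thesis using prc uc[of m] by auto
  qed
  have isol3: "p n \<^bold>* star (u m) \<^bold>* r n = \<^bold>0" for m n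
  proof (cases "valid (prod_decode n) \<and> valid (prod_decode m)")
    case True
    obtain j s j' s' where n: "prod_decode n = (j, s)" "prod_decode m = (j', s')" by (metis surj_pair)
    have val: "valid (j, s)" "valid (j', s')" using True n by auto
    then have s': "s' < M (Suc j')" "root j' s' \<noteq> s'" by (auto simp: valid_def)
    have um: "u m = v (j', s')" using val n by (simp add: u_def)
    show ?thesis
    proof (cases "j = j'")
      case True
      \<comment> \<open>If \<open>s'\<close> were equal to \<open>root j s\<close>, it would be its
        own root. So an adjoint edge never occupies the corner of an edge.\<close>
      have "s' \<noteq> root j s \<or> root j' s' \<noteq> s"
        using True s' root_root val by (auto simp: valid_def)
      then show ?thesis
        using same[OF n(1) val(1), of s' "root j' s'" "star (v (j', s'))"] True v(3)[OF s'(1)] root[OF s'(1)] s'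
        by (auto simp: um)
    next
      case False
      then show ?thesis
        using other[OF n(1) val(1) v(3)[OF s'(1)]] root[OF s'(1)] s' by (simp add: um)
    qed
  next
    case False
    then have "u m = \<^bold>0 \<or> p n = \<^bold>0"
      using pr_zero by (auto simp: u_def)
    then show ?thesis using prc uc[of m] by auto
  qed
  have "p n \<in> range q" "r n \<in> range q" for n
    by (auto simp: p_def r_def P_def split: prod.splits)
  then obtain b where b: "b \<in> carrier A"
    "\<And>S. cstar_subalgebra A S \<Longrightarrow> b \<in> S \<Longrightarrow> range q \<subseteq> S \<and> range u \<subseteq> S"
    using joint_generator[of q u p r] qc q_comm uc isol1 isol2 isol3 by metis
  show ?thesis
  proof (intro bexI[of _ b] allI impI)
    show "b \<in> carrier A" by fact
    fix S assume S: "cstar_subalgebra A S" "b \<in> S"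
    interpret cstar_sub A S by unfold_locales (rule S)
    have diag: "e i s s \<in> S" if "s < M i" for i s
    proof -
      have "P i s \<in> S" using b(2)[OF S] by (auto simp: P_def)
      then show ?thesis using that by (simp add: P)
    qed
    have edge: "e (Suc j) (root j s) s \<in> S \<and> F j \<^bold>* e (Suc j) s s \<in> S"
      if s: "s < M (Suc j)" "root j s \<noteq> s" for j s
    proof -
      let ?e = "e (Suc j) (root j s) s" and ?p = "e (Suc j) s s"
      note r = root[OF s(1)]
      note c = e_closed[OF r(1) s(1)] e_closed[OF s(1) s(1)] e_closed[OF s(1) r(1)] F_closed[of j]
      have "u (prod_encode (j, s)) \<in> S" using b(2)[OF S] by auto
      then have uS: "?e \<^bold>+ ?e \<^bold>* F j \<in> S" using s by (simp add: u_def valid_def v_def)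
      \<comment> \<open>Multiplying \<open>F j\<close> by \<open>?p\<close> moves the perturbation
        into the corner with unit \<open>?p\<close>, as \<open>near_partial_isometry\<close>
        demands.\<close>
      have eF: "?e \<^bold>* F j = ?e \<^bold>* (F j \<^bold>* ?p)"
        using c r s by (simp add: e_mult_left flip: F_commute)
      have pF: "?p \<^bold>* (F j \<^bold>* ?p) = F j \<^bold>* ?p"
        using c s by (simp add: e_mult_left flip: F_commute)
      have "nrm (F j \<^bold>* ?p) \<le> nrm (F j) * nrm ?p"
        using norm_times c by simp
      also have "\<dots> \<le> nrm (F j) * 1"
        using norm_projection_le[of ?p] c s by (intro mult_left_mono) (simp_all add: e_star e_mult)
      finally have "nrm (F j \<^bold>* ?p) \<le> 1/4" using F_norm[of j] by simp
      then have e: "?e \<in> S"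
        using c s r uS eF pF
        by (intro near_partial_isometry[of ?e ?p "F j \<^bold>* ?p"])
          (simp_all add: e_mult e_star star_times F_star F_commute times_assoc)
      \<comment> \<open>\<open>star ?e\<close> strips the edge of its off-diagonal factor, leaving
        \<open>?p\<close> plus the entry of \<open>F j\<close>.\<close>
      have "star ?e \<^bold>* (?e \<^bold>+ ?e \<^bold>* F j) = ?p \<^bold>+ F j \<^bold>* ?p"
        using c s r by (simp add: times_plus e_star e_mult e_mult_left F_commute)
      then have "(?p \<^bold>+ F j \<^bold>* ?p) \<^bold>+ (-1) \<^bold>\<cdot> ?p \<in> S"
        using e uS diag s by (metis sub_plus sub_scale sub_star sub_times)
      then show ?thesis
        using e c by (simp add: plus_minus_cancel)
    qed
    \<comment> \<open>The path from \<open>r\<close> to \<open>s\<close> leads through the last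
      sibling of \<open>r\<close> and the last sibling of \<open>s\<close>. Its middle part comes
      from the parents by \<open>e_lst\<close>; the outer parts are edges or their adjoints, or
      diagonal units when the index is itself last.\<close>
    have units: "r < M i \<Longrightarrow> s < M i \<Longrightarrow> e i r s \<in> S" for i r s
    proof (induction i arbitrary: r s)
      case 0
      then show ?case using diag[of 0 0] by (simp add: M_0)
    next
      case (Suc i)
      let ?a = "par i r" and ?b = "par i s"
      have star_r: "e (Suc i) r (root i r) \<in> S"
        using edge[of r i] diag[of r "Suc i"] Suc.prems root[of r i] sub_star[of "e (Suc i) (root i r) r"]
        by (cases "root i r = r") (auto simp: e_star)
      have star_s: "e (Suc i) (root i s) s \<in> S"
        using edge[of s i] diag[of s "Suc i"] Suc.prems
        by (cases "root i s = s") auto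
      have "e i ?a ?b \<^bold>* e (Suc i) (root i s) (root i s) \<in> S"
        using Suc par_less root diag by simp
      then have "e (Suc i) (root i r) (root i s) \<in> S"
        using e_lst[of ?a i ?b] par_less Suc.prems by (simp add: root_def)
      then have "e (Suc i) r (root i r) \<^bold>* (e (Suc i) (root i r) (root i s) \<^bold>* e (Suc i) (root i s) s) \<in> S"
        using star_r star_s by simp
      then show ?case
        using Suc.prems root by (simp add: e_mult)
    qed
    moreover have "F j \<^bold>* e (Suc j) s s \<in> S" if "s < M (Suc j)" for j s
    proof (cases "root j s = s")
      \<comment> \<open>No edge carries the entry at a last child; there \<open>F_lst\<close> makes
        it a multiple of a diagonal unit.\<close>
      case True
      then show ?thesis
        using F_lst[of "par j s" j] par_less[OF that] diag[OF that] by (auto simp: root_def)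
    qed (use edge that in blast)
    ultimately show "(\<forall>i r s. r < M i \<longrightarrow> s < M i \<longrightarrow> e i r s \<in> S) \<and>
       (\<forall>j s. s < M (Suc j) \<longrightarrow> F j \<^bold>* e (Suc j) s s \<in> S)"
      by blast
  qed
qed

end

section \<open>Diagonal matrices and matrix units\<close>

text \<open>The coefficient \<open>a\<close> is built in, so that adjoints and products with
  diagonal matrices keep the form.\<close>

definition unit_mat :: "nat \<Rightarrow> nat \<Rightarrow> nat \<Rightarrow> complex \<Rightarrow> complex mat" where
  "unit_mat n r s a = Matrix.mat n n (\<lambda>(p, q). if p = r \<and> q = s then a else 0)"

definition diagonal_mat_of :: "nat \<Rightarrow> (nat \<Rightarrow> complex) \<Rightarrow> complex mat" where
  "diagonal_mat_of n g = Matrix.mat n n (\<lambda>(p, q). if p = q then g p else 0)"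

lemma unit_mat_carrier [simp]: "unit_mat n r s a \<in> carrier_mat n n"
  by (simp add: unit_mat_def)

lemma diagonal_mat_of_carrier [simp]: "diagonal_mat_of n g \<in> carrier_mat n n"
  by (simp add: diagonal_mat_of_def)

lemma unit_mat_index [simp]:
  "p < n \<Longrightarrow> q < n \<Longrightarrow> unit_mat n r s a $$ (p, q) = (if p = r \<and> q = s then a else 0)"
  by (simp add: unit_mat_def)

lemma diagonal_mat_of_index [simp]:
  "p < n \<Longrightarrow> q < n \<Longrightarrow> diagonal_mat_of n g $$ (p, q) = (if p = q then g p else 0)"
  by (simp add: diagonal_mat_of_def)

lemma mat_times_unit_mat:
  assumes "A \<in> carrier_mat n n" "p < n" "q < n" "r < n"
  shows "(A * unit_mat n r s a) $$ (p, q) = (if q = s then A $$ (p, r) * a else 0)"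
proof -
  have "(A * unit_mat n r s a) $$ (p, q)
      = (\<Sum>i\<in>{0..<n}. A $$ (p, i) * (if i = r \<and> q = s then a else 0))"
    using assms by (auto simp: scalar_prod_def unit_mat_def intro!: sum.cong)
  also have "\<dots> = (\<Sum>i\<in>{0..<n}. if i = r then (if q = s then A $$ (p, r) * a else 0) else 0)"
    by (intro sum.cong) auto
  finally show ?thesis using assms by simp
qed

lemma unit_mat_times_diagonal:
  assumes "r < n" "s < n"
  shows "unit_mat n r s a * diagonal_mat_of n g = unit_mat n r s (a * g s)"
proof (rule eq_matI)
  fix p q assume "p < dim_row (unit_mat n r s (a * g s))" "q < dim_col (unit_mat n r s (a * g s))"
  then have pq: "p < n" "q < n" by (auto simp: unit_mat_def)
  have "(unit_mat n r s a * diagonal_mat_of n g) $$ (p, q)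
      = (\<Sum>i\<in>{0..<n}. (if p = r \<and> i = s then a else 0) * (if i = q then g i else 0))"
    using pq by (auto simp: scalar_prod_def unit_mat_def diagonal_mat_of_def intro!: sum.cong)
  also have "\<dots> = (\<Sum>i\<in>{0..<n}. if i = q then (if p = r \<and> q = s then a * g s else 0) else 0)"
    by (intro sum.cong) auto
  finally show "(unit_mat n r s a * diagonal_mat_of n g) $$ (p, q) = unit_mat n r s (a * g s) $$ (p, q)"
    using pq by simp
qed (auto simp: unit_mat_def diagonal_mat_of_def)

lemma diagonal_times_unit_mat:
  assumes "r < n"
  shows "diagonal_mat_of n g * unit_mat n r s a = unit_mat n r s (g r * a)"
proof (rule eq_matI)
  fix p q assume "p < dim_row (unit_mat n r s (g r * a))" "q < dim_col (unit_mat n r s (g r * a))"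
  then have "p < n" "q < n" by (auto simp: unit_mat_def)
  then show "(diagonal_mat_of n g * unit_mat n r s a) $$ (p, q) = unit_mat n r s (g r * a) $$ (p, q)"
    using assms by (auto simp: mat_times_unit_mat[of _ n])
qed (auto simp: unit_mat_def diagonal_mat_of_def)

lemma unit_mat_times_unit_mat:
  assumes "r < n" "s < n" "s' < n"
  shows "unit_mat n r s a * unit_mat n s' t b = (if s = s' then unit_mat n r t (a * b) else 0\<^sub>m n n)"
proof (rule eq_matI)
  fix p q assume "p < dim_row (if s = s' then unit_mat n r t (a * b) else 0\<^sub>m n n)"
    "q < dim_col (if s = s' then unit_mat n r t (a * b) else 0\<^sub>m n n)"
  then have "p < n" "q < n" by (auto simp: unit_mat_def split: if_splits)
  then show "(unit_mat n r s a * unit_mat n s' t b) $$ (p, q) =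
      (if s = s' then unit_mat n r t (a * b) else 0\<^sub>m n n) $$ (p, q)"
    using assms by (cases "s = s'") (simp_all add: mat_times_unit_mat[of _ n])
qed (simp_all add: unit_mat_def)

lemma diagonal_times_diagonal:
  "diagonal_mat_of n g * diagonal_mat_of n h = diagonal_mat_of n (\<lambda>p. g p * h p)"
proof (rule eq_matI)
  fix p q assume "p < dim_row (diagonal_mat_of n (\<lambda>p. g p * h p))" "q < dim_col (diagonal_mat_of n (\<lambda>p. g p * h p))"
  then have pq: "p < n" "q < n" by (auto simp: diagonal_mat_of_def)
  have "(diagonal_mat_of n g * diagonal_mat_of n h) $$ (p, q)
      = (\<Sum>i\<in>{0..<n}. (if p = i then g p else 0) * (if i = q then h i else 0))"
    using pq by (simp add: scalar_prod_def diagonal_mat_of_def)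
  also have "\<dots> = (\<Sum>i\<in>{0..<n}. if i = p then (if p = q then g p * h p else 0) else 0)"
    by (intro sum.cong) auto
  finally show "(diagonal_mat_of n g * diagonal_mat_of n h) $$ (p, q) = diagonal_mat_of n (\<lambda>p. g p * h p) $$ (p, q)"
    using pq by simp
qed (auto simp: diagonal_mat_of_def)

section \<open>Adjoints and operator norms\<close>

lemma mat_adjoint_index:
  assumes "A \<in> carrier_mat n n" "p < n" "q < n"
  shows "mat_adjoint A $$ (p, q) = cnj (A $$ (q, p))"
  using assms by (auto simp: mat_adjoint_def mat_of_rows_def)

lemma mat_adjoint_carrier: "A \<in> carrier_mat n n \<Longrightarrow> mat_adjoint A \<in> carrier_mat n n"
  by (auto simp: mat_adjoint_def mat_of_rows_def)

lemma mat_adjoint_eqI: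
  assumes "A \<in> carrier_mat n n" "C \<in> carrier_mat n n"
    and "\<And>p q. p < n \<Longrightarrow> q < n \<Longrightarrow> cnj (A $$ (q, p)) = C $$ (p, q)"
  shows "mat_adjoint A = C"
proof (rule eq_matI)
  fix p q assume "p < dim_row C" "q < dim_col C"
  then have "p < n" "q < n" using assms(2) by auto
  then show "mat_adjoint A $$ (p, q) = C $$ (p, q)"
    using assms(3) by (simp add: mat_adjoint_index[OF assms(1)])
qed (use mat_adjoint_carrier[OF assms(1)] assms(2) in auto)

lemma mat_adjoint_unit_mat: "mat_adjoint (unit_mat n r s a) = unit_mat n s r (cnj a)"
  by (rule mat_adjoint_eqI[of _ n]) auto

lemma mat_adjoint_diagonal:
  "mat_adjoint (diagonal_mat_of n g) = diagonal_mat_of n (\<lambda>p. cnj (g p))"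
  by (rule mat_adjoint_eqI[of _ n]) auto

text \<open>Each coordinate of a vector is scaled by at most \<open>K\<close> in modulus, hence so
  is the Euclidean length. The zero vector shows that the set under \<open>Sup\<close> is
  nonempty.\<close>

lemma mat_op_norm_diagonal_le:
  assumes "\<And>p. p < n \<Longrightarrow> cmod (g p) \<le> K" "0 \<le> K"
  shows "mat_op_norm (diagonal_mat_of n g) \<le> K"
  unfolding mat_op_norm_def
proof (rule cSup_least, goal_cases)
  case 1
  show ?case
    by (auto intro!: exI[of _ "0\<^sub>v n"] simp: L2_set_def diagonal_mat_of_def)
next
  case (2 b)
  then obtain v where v: "v \<in> carrier_vec n" "L2_set (\<lambda>p. cmod (vec_index v p)) {..<n} \<le> 1"
    and b: "b = L2_set (\<lambda>p. cmod (vec_index (diagonal_mat_of n g *\<^sub>v v) p)) {..<n}"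
    by (auto simp: diagonal_mat_of_def)
  have "vec_index (diagonal_mat_of n g *\<^sub>v v) p = g p * vec_index v p" if "p < n" for p
  proof -
    have "vec_index (diagonal_mat_of n g *\<^sub>v v) p = (\<Sum>i\<in>{0..<n}. (if p = i then g p else 0) * vec_index v i)"
      using that v(1) by (simp add: scalar_prod_def diagonal_mat_of_def)
    also have "\<dots> = (\<Sum>i\<in>{0..<n}. if i = p then g p * vec_index v p else 0)"
      by (intro sum.cong) auto
    finally show ?thesis using that by simp
  qed
  then have "b \<le> L2_set (\<lambda>p. K * cmod (vec_index v p)) {..<n}"
    unfolding b by (intro L2_set_mono) (auto simp: norm_mult intro!: mult_right_mono assms)
  also have "\<dots> = K * L2_set (\<lambda>p. cmod (vec_index v p)) {..<n}"
    using assms(2) by (simp add: L2_set_right_distrib)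
  also have "\<dots> \<le> K * 1"
    using v(2) assms(2) by (intro mult_left_mono) auto
  finally show ?case by simp
qed

section \<open>Block-diagonal matrices and block projections\<close>

text \<open>Stripping the first block lowers both indices by \<open>n\<close>, which lowers the
  quotients by one and leaves the remainders unchanged.\<close>

lemma diag_block_mat_index:
  assumes "\<And>A. A \<in> set As \<Longrightarrow> A \<in> carrier_mat n n" "p < length As * n" "q < length As * n"
  shows "diag_block_mat As $$ (p, q)
    = (if p div n = q div n then (As ! (p div n)) $$ (p mod n, q mod n) else 0)"
  using assms
proof (induction As arbitrary: p q)
  case (Cons A As)
  have n: "n > 0" using Cons.prems by (cases n) auto
  have A: "dim_row A = n" "dim_col A = n" using Cons.prems by auto
  have d: "dim_row (diag_block_mat As) = length As * n" "dim_col (diag_block_mat As) = length As * n"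
  proof -
    have "map dim_row As = replicate (length As) n" "map dim_col As = replicate (length As) n"
      using Cons.prems(1) by (auto simp: map_replicate_const[symmetric])
    then show "dim_row (diag_block_mat As) = length As * n" "dim_col (diag_block_mat As) = length As * n"
      by (simp_all add: dim_diag_block_mat sum_list_replicate)
  qed
  have IH: "\<And>p q. p < length As * n \<Longrightarrow> q < length As * n \<Longrightarrow> diag_block_mat As $$ (p, q)
    = (if p div n = q div n then (As ! (p div n)) $$ (p mod n, q mod n) else 0)"
    using Cons by simp
  have div: "m div n = Suc ((m - n) div n)" "(m - n) mod n = m mod n" if "m \<ge> n" for m
    using that n le_div_geq le_mod_geq by auto
  show ?case
    using Cons.prems(2,3) n IH[of "p - n" "q - n"] div[of p] div[of q]
    by (auto simp: Let_def A d not_less)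
qed simp

text \<open>Each coordinate of the image is a coordinate of the argument or, outside the block, the
  constant \<open>undefined\<close>.\<close>

lemma continuous_on_block_proj: "continuous_on Z (block_proj d t)"
  unfolding block_proj_def
proof (rule continuous_on_coordinatewise_then_product)
  fix i
  show "continuous_on Z (\<lambda>y. (\<lambda>u\<in>{..<d}. y (t * d + u)) i)"
    by (cases "i < d") (auto intro: continuous_on_subset[OF continuous_on_product_coordinates])
qed

section \<open>Villadsen algebras\<close>

lemma diag_block_mat_map_index:
  assumes "\<And>t. t < m \<Longrightarrow> f t \<in> carrier_mat n n" "p < m * n" "q < m * n"
  shows "diag_block_mat (map f [0..<m]) $$ (p, q)
    = (if p div n = q div n then f (p div n) $$ (p mod n, q mod n) else 0)"
proof -
  have "p div n < m" using assms(2) by (simp add: less_mult_imp_div_less)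
  then show ?thesis
    using assms by (subst diag_block_mat_index[of _ n]) auto
qed

context villadsen_data
begin

abbreviation "Y \<equiv> villadsen_space X c"
abbreviation "N \<equiv> villadsen_size k l n0"
abbreviation "D \<equiv> villadsen_dim c"
abbreviation "alg \<equiv> villadsen_block X c k l n0"
abbreviation "\<phi> \<equiv> villadsen_map X c k l s x n0 \<sigma>"

section \<open>The tree of matrix indices\<close>

text \<open>The permuted row \<open>\<sigma> i p\<close> lies in the diagonal block
  \<open>dig i p\<close> at position \<open>par i p\<close>. Thus the rows of level
  \<open>i + 1\<close> become children of the rows of level \<open>i\<close>, one for each block,
  and the permutation disappears from later formulas.\<close>

definition dig :: "nat \<Rightarrow> nat \<Rightarrow> nat" where
  "dig i p = \<sigma> i p div N i"
definition par :: "nat \<Rightarrow> nat \<Rightarrow> nat" where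
  "par i p = \<sigma> i p mod N i"
definition child :: "nat \<Rightarrow> nat \<Rightarrow> nat \<Rightarrow> nat" where
  "child i t a = inv_into UNIV (\<sigma> i) (t * N i + a)"

definition blocks :: "nat \<Rightarrow> nat list" where
  "blocks i = concat (map (\<lambda>t. replicate (s i t) t) [0..<c i])"

text \<open>The point at which the \<open>t\<close>-th diagonal block evaluates its function.
  Projections and point evaluations are treated alike from here on.\<close>

definition ev :: "nat \<Rightarrow> nat \<Rightarrow> (nat \<Rightarrow> 'a) \<Rightarrow> nat \<Rightarrow> 'a" where
  "ev i t y = (if t < l i then block_proj (D i) (blocks i ! t) y else x i (t - l i))"

lemma N_Suc: "N (Suc i) = (l i + k i) * N i"
  by (simp add: villadsen_size_def)

lemma N_0: "N 0 = n0"
  by (simp add: villadsen_size_def)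

lemma D_Suc: "D (Suc i) = c i * D i"
  by (simp add: villadsen_dim_def)

lemma D_pos: "D i > 0"
  using c_pos by (simp add: villadsen_dim_def prod_pos Suc_le_eq)

lemma N_pos: "N i > 0"
  using l_pos n0_pos by (induction i) (auto simp: N_Suc N_0 Suc_le_eq)

lemma \<sigma>_less: "p < N (Suc i) \<Longrightarrow> \<sigma> i p < N (Suc i)"
  using \<sigma>_permutes[of i] by (metis lessThan_iff permutes_in_image)

lemma par_less: "par i p < N i"
  using N_pos by (simp add: par_def)

lemma dig_less: "p < N (Suc i) \<Longrightarrow> dig i p < l i + k i"
  using \<sigma>_less[of p i] by (simp add: dig_def N_Suc less_mult_imp_div_less)

lemma child_par_dig: "child i (dig i p) (par i p) = p"
  unfolding child_def dig_def par_def using permutes_inverses(2)[OF \<sigma>_permutes] by simp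

lemma par_child: "a < N i \<Longrightarrow> par i (child i t a) = a"
  and dig_child: "a < N i \<Longrightarrow> dig i (child i t a) = t"
  unfolding child_def dig_def par_def by (simp_all add: permutes_inverses(1)[OF \<sigma>_permutes])

lemma child_less:
  assumes "t < l i + k i" "a < N i"
  shows "child i t a < N (Suc i)"
proof -
  have "t * N i + a < Suc t * N i" using assms by simp
  also have "\<dots> \<le> (l i + k i) * N i" using assms by (intro mult_right_mono) auto
  finally have "t * N i + a < N (Suc i)" by (simp add: N_Suc)
  then show ?thesis
    unfolding child_def using permutes_inv[OF \<sigma>_permutes[of i]] by (metis lessThan_iff permutes_in_image)
qed

lemma eq_iff_par_dig: "p = q \<longleftrightarrow> par i p = par i q \<and> dig i p = dig i q"
  by (metis child_par_dig)

lemma length_blocks: "length (blocks i) = l i"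
  unfolding blocks_def using s_sum[of i]
  by (simp add: length_concat comp_def sum_list_sum_nth atLeast0LessThan)

text \<open>Every projection occurs because all multiplicities \<open>s i t\<close> are positive;
  this makes every coordinate function available in \<open>base_coordinate\<close>.\<close>

lemma set_blocks: "set (blocks i) = {..<c i}"
  unfolding blocks_def using s_pos[of _ i] by (fastforce simp: Suc_le_eq)

lemma villadsen_diag_eq:
  "villadsen_diag c k s x i F y = map (\<lambda>t. F (ev i t y)) [0..<l i + k i]"
proof (rule nth_equalityI)
  have 1: "concat (map (\<lambda>t. replicate (s i t) (F (block_proj (D i) t y))) [0..<c i])
      = map (\<lambda>t. F (block_proj (D i) t y)) (blocks i)"
    by (simp add: blocks_def map_concat comp_def)
  show "length (villadsen_diag c k s x i F y) = length (map (\<lambda>t. F (ev i t y)) [0..<l i + k i])"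
    unfolding villadsen_diag_def 1 by (simp add: length_blocks)
  show "villadsen_diag c k s x i F y ! t = map (\<lambda>t. F (ev i t y)) [0..<l i + k i] ! t"
    if "t < length (villadsen_diag c k s x i F y)" for t
    using that unfolding villadsen_diag_def 1 by (auto simp: nth_append length_blocks ev_def)
qed

section \<open>The spaces and the evaluation maps\<close>

lemma Y_index: "y \<in> Y i \<Longrightarrow> q < D i \<Longrightarrow> y q \<in> X"
  by (auto simp: villadsen_space_def)

lemma block_less:
  assumes "t < c i" "q < D i"
  shows "t * D i + q < D (Suc i)"
proof -
  have "t * D i + q < Suc t * D i" using assms by simp
  also have "\<dots> \<le> c i * D i" using assms by (intro mult_right_mono) auto
  finally show ?thesis by (simp add: D_Suc)
qed

lemma ev_in: "t < l i + k i \<Longrightarrow> y \<in> Y (Suc i) \<Longrightarrow> ev i t y \<in> Y i"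
proof (cases "t < l i")
  case True
  assume y: "y \<in> Y (Suc i)"
  have "blocks i ! t < c i"
    using nth_mem[of t "blocks i"] True by (simp add: length_blocks set_blocks)
  then show ?thesis
    using True y block_less by (auto simp: ev_def block_proj_def villadsen_space_def PiE_iff)
next
  case False
  assume "t < l i + k i"
  then have "x i (t - l i) \<in> x i ` {..<k i}" using False by auto
  then show ?thesis using E_subset[of i] False by (auto simp: ev_def)
qed

lemma ev_continuous: "continuous_on Z (ev i t)"
  unfolding ev_def by (cases "t < l i") (auto intro: continuous_on_block_proj)

lemma Y_nonempty: "Y i \<noteq> {}"
  using X_nonempty by (simp add: villadsen_space_def PiE_eq_empty_iff)

text \<open>Tychonoff's theorem: inside the full product, the extensional functions form a product
  with the one-point factor \<open>{undefined}\<close> outside the initial segment.\<close>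

lemma Y_compact: "compact (Y i)"
proof -
  have "Y i = PiE UNIV (\<lambda>q. if q < D i then X else {undefined})"
    by (auto simp: villadsen_space_def PiE_def extensional_def Pi_def split: if_splits)
  moreover have "compactin (product_topology (\<lambda>_. euclidean) UNIV)
      (PiE UNIV (\<lambda>q. if q < D i then X else {undefined}))"
    unfolding compactin_PiE using X_compact by auto
  ultimately show ?thesis by (simp add: euclidean_product_topology)
qed

section \<open>The algebras and connecting maps in coordinates\<close>

lemma carrier_alg:
  "F \<in> carrier (alg i) \<longleftrightarrow> F \<in> Y i \<rightarrow>\<^sub>E carrier_mat (N i) (N i) \<and>
     (\<forall>p<N i. \<forall>q<N i. continuous_on (Y i) (\<lambda>y. F y $$ (p, q)))"
  by (simp add: villadsen_block_def matrix_algebra_def)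

lemma alg_ops:
  "zero_el (alg i) = (\<lambda>y\<in>Y i. 0\<^sub>m (N i) (N i))"
  "plus_el (alg i) F G = (\<lambda>y\<in>Y i. F y + G y)"
  "scale_el (alg i) z F = (\<lambda>y\<in>Y i. z \<cdot>\<^sub>m F y)"
  "times_el (alg i) F G = (\<lambda>y\<in>Y i. F y * G y)"
  "star_el (alg i) F = (\<lambda>y\<in>Y i. mat_adjoint (F y))"
  "norm_el (alg i) F = (SUP y\<in>Y i. mat_op_norm (F y))"
  by (simp_all add: villadsen_block_def matrix_algebra_def)

lemma \<phi>_apply:
  assumes "F \<in> carrier (alg i)" "y \<in> Y (Suc i)" "p < N (Suc i)" "q < N (Suc i)"
  shows "\<phi> i F y $$ (p, q) = (if dig i p = dig i q then F (ev i (dig i p) y) $$ (par i p, par i q) else 0)"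
proof -
  have "F (ev i t y) \<in> carrier_mat (N i) (N i)" if "t < l i + k i" for t
    using ev_in[OF that assms(2)] assms(1) by (auto simp: carrier_alg)
  then show ?thesis
    using assms(2-) diag_block_mat_map_index[of "l i + k i" "\<lambda>t. F (ev i t y)" "N i" "\<sigma> i p" "\<sigma> i q"]
      \<sigma>_less[of _ i]
    by (simp add: villadsen_map_def Let_def villadsen_diag_eq N_Suc dig_def par_def)
qed

lemma \<phi>_closed:
  assumes F: "F \<in> carrier (alg i)"
  shows "\<phi> i F \<in> carrier (alg (Suc i))"
  unfolding carrier_alg
proof (intro conjI allI impI)
  show "\<phi> i F \<in> Y (Suc i) \<rightarrow>\<^sub>E carrier_mat (N (Suc i)) (N (Suc i))"
    by (auto simp: villadsen_map_def Let_def)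
  fix p q assume pq: "p < N (Suc i)" "q < N (Suc i)"
  have "continuous_on (Y (Suc i)) (\<lambda>y. F (ev i (dig i p) y) $$ (par i p, par i q))"
    by (rule continuous_on_compose2[of "Y i" "\<lambda>y. F y $$ (par i p, par i q)"])
      (use F par_less ev_continuous ev_in dig_less pq in \<open>auto simp: carrier_alg\<close>)
  then show "continuous_on (Y (Suc i)) (\<lambda>y. \<phi> i F y $$ (p, q))"
    by (cases "dig i p = dig i q") (simp_all add: \<phi>_apply[OF F _ pq] cong: continuous_on_cong)
qed

section \<open>Elements with one entry, and diagonal elements\<close>

definition unit_el :: "nat \<Rightarrow> nat \<Rightarrow> nat \<Rightarrow> ((nat \<Rightarrow> 'a) \<Rightarrow> complex) \<Rightarrow> (nat \<Rightarrow> 'a) \<Rightarrow> complex mat" where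
  "unit_el i a b f = (\<lambda>y\<in>Y i. unit_mat (N i) a b (f y))"

text \<open>Diagonal elements are treated separately because the connecting maps preserve them,
  whereas the image of a one-entry element in general has an entry in every block.\<close>

definition diag_el :: "nat \<Rightarrow> (nat \<Rightarrow> (nat \<Rightarrow> 'a) \<Rightarrow> complex) \<Rightarrow> (nat \<Rightarrow> 'a) \<Rightarrow> complex mat" where
  "diag_el i h = (\<lambda>y\<in>Y i. diagonal_mat_of (N i) (\<lambda>p. h p y))"

lemma unit_el_carrier [simp]:
  assumes "continuous_on (Y i) f"
  shows "unit_el i a b f \<in> carrier (alg i)"
  unfolding carrier_alg
proof (intro conjI allI impI)
  fix p q assume "p < N i" "q < N i"
  then show "continuous_on (Y i) (\<lambda>y. unit_el i a b f y $$ (p, q))"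
    using assms by (cases "p = a \<and> q = b") (auto simp: unit_el_def cong: continuous_on_cong)
qed (simp add: unit_el_def)

lemma diag_el_carrier [simp]:
  assumes "\<And>p. p < N i \<Longrightarrow> continuous_on (Y i) (h p)"
  shows "diag_el i h \<in> carrier (alg i)"
  unfolding carrier_alg
proof (intro conjI allI impI)
  fix p q assume "p < N i" "q < N i"
  then show "continuous_on (Y i) (\<lambda>y. diag_el i h y $$ (p, q))"
    using assms by (cases "p = q") (auto simp: diag_el_def cong: continuous_on_cong)
qed (simp add: diag_el_def)

lemma unit_el_diag: "unit_el i a a f = diag_el i (\<lambda>p y. if p = a then f y else 0)"
  by (auto simp: unit_el_def diag_el_def unit_mat_def diagonal_mat_of_def intro!: restrict_ext eq_matI)

lemma unit_el_cong: "(\<And>y. y \<in> Y i \<Longrightarrow> f y = f' y) \<Longrightarrow> unit_el i a b f = unit_el i a b f'"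
  by (auto simp: unit_el_def intro!: restrict_ext)

lemma unit_el_times:
  assumes "a < N i" "b < N i" "b' < N i"
  shows "times_el (alg i) (unit_el i a b f) (unit_el i b' d g)
    = (if b = b' then unit_el i a d (\<lambda>y. f y * g y) else zero_el (alg i))"
  using assms by (auto simp: alg_ops unit_el_def unit_mat_times_unit_mat intro!: restrict_ext)

lemma unit_times_diag:
  assumes "a < N i" "b < N i"
  shows "times_el (alg i) (unit_el i a b f) (diag_el i h) = unit_el i a b (\<lambda>y. f y * h b y)"
  using assms by (auto simp: alg_ops unit_el_def diag_el_def unit_mat_times_diagonal intro!: restrict_ext)

lemma diag_times_unit:
  assumes "a < N i"
  shows "times_el (alg i) (diag_el i h) (unit_el i a b f) = unit_el i a b (\<lambda>y. h a y * f y)"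
  using assms by (auto simp: alg_ops unit_el_def diag_el_def diagonal_times_unit_mat intro!: restrict_ext)

lemma diag_el_times:
  "times_el (alg i) (diag_el i h) (diag_el i g) = diag_el i (\<lambda>p y. h p y * g p y)"
  by (auto simp: alg_ops diag_el_def diagonal_times_diagonal intro!: restrict_ext)

lemma unit_el_star: "star_el (alg i) (unit_el i a b f) = unit_el i b a (\<lambda>y. cnj (f y))"
  by (auto simp: alg_ops unit_el_def mat_adjoint_unit_mat intro!: restrict_ext)

lemma diag_el_star: "star_el (alg i) (diag_el i h) = diag_el i (\<lambda>p y. cnj (h p y))"
  by (auto simp: alg_ops diag_el_def mat_adjoint_diagonal intro!: restrict_ext)

lemma unit_el_plus: "plus_el (alg i) (unit_el i a b f) (unit_el i a b g) = unit_el i a b (\<lambda>y. f y + g y)"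
  by (auto simp: alg_ops unit_el_def unit_mat_def intro!: restrict_ext eq_matI)

lemma unit_el_scale: "scale_el (alg i) z (unit_el i a b f) = unit_el i a b (\<lambda>y. z * f y)"
  by (auto simp: alg_ops unit_el_def unit_mat_def intro!: restrict_ext eq_matI)

lemma alg_eqI:
  assumes "F \<in> carrier (alg i)" "G \<in> carrier (alg i)"
    and "\<And>y p q. y \<in> Y i \<Longrightarrow> p < N i \<Longrightarrow> q < N i \<Longrightarrow> F y $$ (p, q) = G y $$ (p, q)"
  shows "F = G"
proof (rule PiE_ext[of F "Y i" "\<lambda>_. carrier_mat (N i) (N i)" G])
  fix y assume y: "y \<in> Y i"
  then have "F y \<in> carrier_mat (N i) (N i)" "G y \<in> carrier_mat (N i) (N i)"
    using assms by (auto simp: carrier_alg)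
  then show "F y = G y"
    using assms(3)[OF y] by (intro eq_matI) auto
qed (use assms in \<open>auto simp: carrier_alg\<close>)

lemma \<phi>_diag_el:
  assumes "\<And>p. p < N i \<Longrightarrow> continuous_on (Y i) (h p)"
  shows "\<phi> i (diag_el i h) = diag_el (Suc i) (\<lambda>p y. h (par i p) (ev i (dig i p) y))"
proof (rule alg_eqI[of _ "Suc i"])
  have h: "diag_el i h \<in> carrier (alg i)" using assms by simp
  then show "\<phi> i (diag_el i h) \<in> carrier (alg (Suc i))" by (rule \<phi>_closed)
  show "diag_el (Suc i) (\<lambda>p y. h (par i p) (ev i (dig i p) y)) \<in> carrier (alg (Suc i))"
  proof (rule diag_el_carrier)
    fix p assume "p < N (Suc i)"
    then show "continuous_on (Y (Suc i)) (\<lambda>y. h (par i p) (ev i (dig i p) y))"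
      by (intro continuous_on_compose2[OF assms[OF par_less] ev_continuous])
        (use ev_in dig_less in auto)
  qed
  fix y p q assume ypq: "y \<in> Y (Suc i)" "p < N (Suc i)" "q < N (Suc i)"
  have "diag_el i h (ev i (dig i p) y) $$ (par i p, par i q)
      = (if par i p = par i q then h (par i p) (ev i (dig i p) y) else 0)"
    using ev_in[OF dig_less[OF ypq(2)] ypq(1)] par_less by (simp add: diag_el_def)
  then show "\<phi> i (diag_el i h) y $$ (p, q) = diag_el (Suc i) (\<lambda>p y. h (par i p) (ev i (dig i p) y)) y $$ (p, q)"
    unfolding \<phi>_apply[OF h ypq] using ypq eq_iff_par_dig[of p q i] by (auto simp: diag_el_def)
qed

text \<open>The image of a one-entry element is a sum over all blocks; multiplying by a unit in the
  row \<open>child i t b\<close> keeps only the block \<open>t\<close>. The product form avoids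
  handling the sum.\<close>

lemma \<phi>_unit_times_unit:
  assumes "a < N i" "b < N i" "t < l i + k i" and f: "continuous_on (Y i) f"
    and g: "continuous_on (Y (Suc i)) g"
  shows "times_el (alg (Suc i)) (\<phi> i (unit_el i a b f)) (unit_el (Suc i) (child i t b) d g)
    = unit_el (Suc i) (child i t a) d (\<lambda>y. f (ev i t y) * g y)"
proof -
  have F: "unit_el i a b f \<in> carrier (alg i)" using f by simp
  have c: "child i t a < N (Suc i)" "child i t b < N (Suc i)" using child_less assms by auto
  have "\<phi> i (unit_el i a b f) y * unit_mat (N (Suc i)) (child i t b) d (g y)
      = unit_mat (N (Suc i)) (child i t a) d (f (ev i t y) * g y)" if y: "y \<in> Y (Suc i)" for y
  proof (rule eq_matI)
    have \<phi>c: "\<phi> i (unit_el i a b f) y \<in> carrier_mat (N (Suc i)) (N (Suc i))"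
      using \<phi>_closed[OF F] y by (auto simp: carrier_alg)
    then show "dim_row (\<phi> i (unit_el i a b f) y * unit_mat (N (Suc i)) (child i t b) d (g y))
        = dim_row (unit_mat (N (Suc i)) (child i t a) d (f (ev i t y) * g y))"
      "dim_col (\<phi> i (unit_el i a b f) y * unit_mat (N (Suc i)) (child i t b) d (g y))
        = dim_col (unit_mat (N (Suc i)) (child i t a) d (f (ev i t y) * g y))"
      by (auto simp: unit_mat_def)
    fix p q assume "p < dim_row (unit_mat (N (Suc i)) (child i t a) d (f (ev i t y) * g y))"
      "q < dim_col (unit_mat (N (Suc i)) (child i t a) d (f (ev i t y) * g y))"
    then have pq: "p < N (Suc i)" "q < N (Suc i)" by (auto simp: unit_mat_def)
    have e: "ev i t y \<in> Y i" using ev_in assms y by simp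
    have eq: "\<phi> i (unit_el i a b f) y $$ (p, child i t b) = (if p = child i t a then f (ev i t y) else 0)"
    proof -
      have "unit_el i a b f (ev i t y) $$ (par i p, b) = (if par i p = a then f (ev i t y) else 0)"
        using e par_less assms(2) by (simp add: unit_el_def)
      then show ?thesis
        unfolding \<phi>_apply[OF F y pq(1) c(2)]
        using assms(1,2) eq_iff_par_dig[of p "child i t a" i] by (auto simp: par_child dig_child)
    qed
    show "(\<phi> i (unit_el i a b f) y * unit_mat (N (Suc i)) (child i t b) d (g y)) $$ (p, q)
        = unit_mat (N (Suc i)) (child i t a) d (f (ev i t y) * g y) $$ (p, q)"
      unfolding mat_times_unit_mat[OF \<phi>c pq c(2)] unit_mat_index[OF pq] eq by simp
  qed
  then show ?thesis
    by (auto simp: alg_ops unit_el_def intro!: restrict_ext)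
qed


text \<open>The image of a scalar function \<open>f\<close> on \<open>Y 0\<close> in the \<open>i\<close>-th algebra is diagonal, with entries
  \<open>f \<circ> base i p\<close>.\<close>

primrec base :: "nat \<Rightarrow> nat \<Rightarrow> (nat \<Rightarrow> 'a) \<Rightarrow> nat \<Rightarrow> 'a" where
  "base 0 p y = y"
| "base (Suc i) p y = base i (par i p) (ev i (dig i p) y)"

lemma base_in: "p < N i \<Longrightarrow> y \<in> Y i \<Longrightarrow> base i p y \<in> Y 0"
proof (induction i arbitrary: p y)
  case (Suc i)
  then show ?case
    using Suc.IH[OF par_less ev_in[OF dig_less]] by simp
qed simp

lemma base_continuous: "p < N i \<Longrightarrow> continuous_on (Y i) (base i p)"
proof (induction i arbitrary: p)
  case 0
  then show ?case by (simp add: continuous_on_id)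
next
  case (Suc i)
  have "continuous_on (Y (Suc i)) (\<lambda>y. base i (par i p) (ev i (dig i p) y))"
    by (rule continuous_on_compose2[OF Suc.IH[OF par_less] ev_continuous])
      (use Suc.prems ev_in dig_less in auto)
  then show ?case by simp
qed

text \<open>The last block is a point evaluation, as \<open>k i\<close> is positive, so the entry no
  longer depends on \<open>y\<close>. This yields \<open>F_lst\<close> in the limit.\<close>

lemma base_last:
  assumes "a < N i"
  shows "base (Suc i) (child i (l i + k i - 1) a) y = base i a (x i (k i - 1))"
proof -
  have "\<not> l i + k i - 1 < l i" "l i + k i - 1 - l i = k i - 1"
    using k_pos[of i] by arith+
  then show ?thesis
    using assms by (simp add: par_child dig_child ev_def)
qed

text \<open>Coordinate \<open>q\<close> at level \<open>i + 1\<close> is coordinate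
  \<open>q mod D i\<close> of the projection with number \<open>q div D i\<close>. That projection
  occurs in some block \<open>u\<close>, so the child in block \<open>u\<close> of the row found at
  level \<open>i\<close> is a witness.\<close>

lemma base_coordinate: "q < D i \<Longrightarrow> \<exists>p<N i. \<forall>y\<in>Y i. base i p y 0 = y q"
proof (induction i arbitrary: q)
  case 0
  then show ?case using N_pos[of 0] by (auto simp: villadsen_dim_def)
next
  case (Suc i)
  define t where "t = q div D i"
  have "t < c i" using Suc.prems by (simp add: t_def D_Suc less_mult_imp_div_less)
  then obtain u where u: "u < l i" "blocks i ! u = t"
    using set_blocks[of i] length_blocks[of i] by (metis in_set_conv_nth lessThan_iff)
  have "q mod D i < D i" using D_pos by simp
  then obtain p where p: "p < N i" "\<And>y. y \<in> Y i \<Longrightarrow> base i p y 0 = y (q mod D i)"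
    using Suc.IH by blast
  show ?case
  proof (intro exI[of _ "child i u p"] conjI ballI)
    show "child i u p < N (Suc i)" using child_less u p by simp
    fix y assume "y \<in> Y (Suc i)"
    then have "ev i u y \<in> Y i" using ev_in u by simp
    then show "base (Suc i) (child i u p) y 0 = y q"
      using p u \<open>q mod D i < D i\<close> div_mult_mod_eq[of q "D i"]
      by (simp add: par_child dig_child ev_def block_proj_def t_def)
  qed
qed

end

text \<open>The union of finite \<open>1/(n+1)\<close>-nets is enumerated. The points may lie
  outside \<open>X\<close>, as only distances to them are used.\<close>

lemma dense_sequence:
  fixes X :: "'a::metric_space set"
  assumes "compact X"
  shows "\<exists>a::nat \<Rightarrow> 'a. \<forall>x\<in>X. \<forall>e>0. \<exists>n. dist x (a n) < e"
proof -
  have tb: "\<forall>e>0. \<exists>F. finite F \<and> X \<subseteq> (\<Union>x\<in>F. ball x e)"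
    using assms unfolding compact_eq_totally_bounded by blast
  have "\<exists>F. finite F \<and> X \<subseteq> (\<Union>x\<in>F. ball x (1 / Suc n))" for n
    by (rule tb[rule_format]) simp
  then obtain F where F: "\<And>n. finite (F n)" "\<And>n. X \<subseteq> (\<Union>x\<in>F n. ball x (1 / Suc n))"
    by metis
  define A where "A = (\<Union>n. F n)"
  have A: "countable A"
    using F(1) by (auto simp: A_def countable_finite)
  have "\<exists>n. dist x (from_nat_into A n) < e" if "x \<in> X" "e > 0" for x e
  proof -
    obtain n where n: "1 / Suc n < e" using nat_approx_posE[OF \<open>e > 0\<close>] by metis
    then obtain y where y: "y \<in> F n" "dist y x < 1 / Suc n" using F(2)[of n] \<open>x \<in> X\<close> by auto
    then have "y \<in> A" by (auto simp: A_def)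
    then show ?thesis
      using A y n from_nat_into_surj[OF A, of y] by (metis dist_commute less_trans)
  qed
  then show ?thesis by blast
qed

section \<open>The limit algebra and its canonical maps\<close>

locale villadsen_limit = villadsen_data X c k l s x n0 \<sigma> + cstar_algebra B
  for X :: "'a::metric_space set" and c k l s x n0 \<sigma>
    and B :: "('b, 'm) star_algebra_scheme" (structure) +
  fixes \<psi>
  assumes lim: "inductive_limit alg \<phi> B \<psi>"
begin

lemma \<psi>_hom: "star_hom (alg i) B (\<psi> i)"
  using lim by (simp add: inductive_limit_def)

lemma \<psi>_closed [simp]: "F \<in> carrier (alg i) \<Longrightarrow> \<psi> i F \<in> carrier B"
  and \<psi>_plus: "F \<in> carrier (alg i) \<Longrightarrow> G \<in> carrier (alg i) \<Longrightarrow>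
    \<psi> i (plus_el (alg i) F G) = \<psi> i F \<^bold>+ \<psi> i G"
  and \<psi>_scale: "F \<in> carrier (alg i) \<Longrightarrow> \<psi> i (scale_el (alg i) z F) = z \<^bold>\<cdot> \<psi> i F"
  and \<psi>_times: "F \<in> carrier (alg i) \<Longrightarrow> G \<in> carrier (alg i) \<Longrightarrow>
    \<psi> i (times_el (alg i) F G) = \<psi> i F \<^bold>* \<psi> i G"
  and \<psi>_star: "F \<in> carrier (alg i) \<Longrightarrow> \<psi> i (star_el (alg i) F) = star (\<psi> i F)"
  using \<psi>_hom[of i] by (simp_all add: star_hom_def)

lemma \<psi>_\<phi>: "F \<in> carrier (alg i) \<Longrightarrow> \<psi> (Suc i) (\<phi> i F) = \<psi> i F"
  using lim by (simp add: inductive_limit_def)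

lemma \<psi>_norm: "F \<in> carrier (alg i) \<Longrightarrow>
    (\<lambda>m. norm_el (alg (i + m)) (connecting_map \<phi> i m F)) \<longlonglongrightarrow> nrm (\<psi> i F)"
  using lim by (simp add: inductive_limit_def)

lemma \<psi>_dense: "b \<in> carrier B \<Longrightarrow> e > 0 \<Longrightarrow> \<exists>i. \<exists>F\<in>carrier (alg i). dist_el B (\<psi> i F) b < e"
  using lim by (simp add: inductive_limit_def)

lemma zero_unit_el: "zero_el (alg i) = unit_el i a b (\<lambda>_. 0)"
  by (auto simp: alg_ops unit_el_def unit_mat_def intro!: restrict_ext eq_matI)

lemma \<psi>_zero [simp]: "\<psi> i (zero_el (alg i)) = \<^bold>0"
proof -
  have "\<psi> i (scale_el (alg i) 0 (unit_el i 0 0 (\<lambda>_. 0))) = 0 \<^bold>\<cdot> \<psi> i (unit_el i 0 0 (\<lambda>_. 0))"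
    by (rule \<psi>_scale) simp
  then show ?thesis by (simp add: unit_el_scale zero_unit_el[of i 0 0])
qed

lemma \<psi>_unit_plus:
  assumes "continuous_on (Y i) f" "continuous_on (Y i) g"
  shows "\<psi> i (unit_el i a b f) \<^bold>+ \<psi> i (unit_el i a b g) = \<psi> i (unit_el i a b (\<lambda>y. f y + g y))"
  using assms by (simp add: unit_el_plus flip: \<psi>_plus)

lemma \<psi>_unit_scale:
  assumes "continuous_on (Y i) f"
  shows "z \<^bold>\<cdot> \<psi> i (unit_el i a b f) = \<psi> i (unit_el i a b (\<lambda>y. z * f y))"
  using assms by (simp add: unit_el_scale flip: \<psi>_scale)

text \<open>The norm in the limit is the limit of the norms of the images at later levels. These
  images are again diagonal, with entries composed with evaluation maps, so the bound
  \<open>K\<close> persists.\<close>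

lemma norm_\<psi>_diag_le:
  assumes "\<And>p. p < N i \<Longrightarrow> continuous_on (Y i) (h p)"
    and "\<And>p y. p < N i \<Longrightarrow> y \<in> Y i \<Longrightarrow> cmod (h p y) \<le> K" "0 \<le> K"
  shows "nrm (\<psi> i (diag_el i h)) \<le> K"
proof (rule LIMSEQ_le_const2[OF \<psi>_norm])
  show "diag_el i h \<in> carrier (alg i)" using assms by simp
  have "norm_el (alg (i + m)) (connecting_map \<phi> i m (diag_el i h)) \<le> K" for m
  proof -
    have "\<exists>h'. connecting_map \<phi> i m (diag_el i h) = diag_el (i + m) h'
        \<and> (\<forall>p<N (i + m). continuous_on (Y (i + m)) (h' p) \<and> (\<forall>y\<in>Y (i + m). cmod (h' p y) \<le> K))"
    proof (induction m)
      case 0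
      then show ?case using assms by auto
    next
      case (Suc m)
      then obtain h' where h': "connecting_map \<phi> i m (diag_el i h) = diag_el (i + m) h'"
        "\<And>p. p < N (i + m) \<Longrightarrow> continuous_on (Y (i + m)) (h' p)"
        "\<And>p y. p < N (i + m) \<Longrightarrow> y \<in> Y (i + m) \<Longrightarrow> cmod (h' p y) \<le> K"
        by blast
      show ?case
      proof (intro exI conjI allI impI ballI)
        show "connecting_map \<phi> i (Suc m) (diag_el i h) = diag_el (i + Suc m)
            (\<lambda>p y. h' (par (i + m) p) (ev (i + m) (dig (i + m) p) y))"
          using \<phi>_diag_el[OF h'(2)] h'(1) by simp
        fix p assume p: "p < N (i + Suc m)"
        show "continuous_on (Y (i + Suc m)) (\<lambda>y. h' (par (i + m) p) (ev (i + m) (dig (i + m) p) y))"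
          by (rule continuous_on_compose2[OF h'(2)[OF par_less] ev_continuous])
            (use p ev_in dig_less in auto)
        fix y assume "y \<in> Y (i + Suc m)"
        then show "cmod (h' (par (i + m) p) (ev (i + m) (dig (i + m) p) y)) \<le> K"
          using h'(3)[OF par_less ev_in[OF dig_less]] p by simp
      qed
    qed
    then obtain h' where h': "connecting_map \<phi> i m (diag_el i h) = diag_el (i + m) h'"
      "\<And>p y. p < N (i + m) \<Longrightarrow> y \<in> Y (i + m) \<Longrightarrow> cmod (h' p y) \<le> K"
      by blast
    show ?thesis
      unfolding h' alg_ops
      by (rule cSUP_least[OF Y_nonempty])
        (use assms(3) h'(2) in \<open>auto simp: diag_el_def intro!: mat_op_norm_diagonal_le\<close>)
  qed
  then show "\<exists>M. \<forall>m\<ge>M. norm_el (alg (i + m)) (connecting_map \<phi> i m (diag_el i h)) \<le> K"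
    by blast
qed

text \<open>\<open>F\<close> is the sum of its one-entry parts; the induction over the set
  \<open>T\<close> of positions adds them one at a time.\<close>

lemma \<psi>_entries:
  assumes sub: "cstar_subalgebra B S" and F: "F \<in> carrier (alg i)"
    and entries: "\<And>p q. p < N i \<Longrightarrow> q < N i \<Longrightarrow> \<psi> i (unit_el i p q (\<lambda>y. F y $$ (p, q))) \<in> S"
  shows "\<psi> i F \<in> S"
proof -
  interpret cstar_sub B S by unfold_locales (rule sub)
  have "\<exists>G\<in>carrier (alg i). \<psi> i G \<in> S \<and> (\<forall>y\<in>Y i. \<forall>p<N i. \<forall>q<N i.
      G y $$ (p, q) = (if (p, q) \<in> T then F y $$ (p, q) else 0))"
    if "finite T" "T \<subseteq> {..<N i} \<times> {..<N i}" for T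
    using that
  proof (induction T)
    case empty
    have "\<psi> i (zero_el (alg i)) \<in> S" by simp
    moreover have "zero_el (alg i) \<in> carrier (alg i)"
      unfolding zero_unit_el[of i 0 0] by simp
    moreover have "zero_el (alg i) y $$ (p, q) = 0" if "y \<in> Y i" "p < N i" "q < N i" for y p q
      using that by (simp add: alg_ops)
    ultimately show ?case by (intro bexI[of _ "zero_el (alg i)"]) simp_all
  next
    case (insert t T)
    obtain a b where t: "t = (a, b)" by (metis surj_pair)
    then have ab: "a < N i" "b < N i" using insert.prems by auto
    have "T \<subseteq> {..<N i} \<times> {..<N i}" using insert.prems by simp
    from insert.IH[OF this] obtain G where G: "G \<in> carrier (alg i)" "\<psi> i G \<in> S"
      and G': "\<forall>y\<in>Y i. \<forall>p<N i. \<forall>q<N i. G y $$ (p, q) = (if (p, q) \<in> T then F y $$ (p, q) else 0)"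
      by (elim bexE conjE) (rule that)
    define U where "U = unit_el i a b (\<lambda>y. F y $$ (a, b))"
    have "continuous_on (Y i) (\<lambda>y. F y $$ (a, b))"
      using F ab by (simp add: carrier_alg)
    then have U: "U \<in> carrier (alg i)" "\<psi> i U \<in> S"
      unfolding U_def using ab by (auto intro: entries)
    have Gy: "G y \<in> carrier_mat (N i) (N i)" "U y \<in> carrier_mat (N i) (N i)" if "y \<in> Y i" for y
      using G(1) U(1) that by (auto simp: carrier_alg)
    have sum: "plus_el (alg i) G U y $$ (p, q) = (if (p, q) \<in> insert t T then F y $$ (p, q) else 0)"
      if "y \<in> Y i" "p < N i" "q < N i" for y p q
    proof -
      have "plus_el (alg i) G U y $$ (p, q) = G y $$ (p, q) + U y $$ (p, q)"
        using that carrier_matD[OF Gy(2)[OF that(1)]] by (simp add: alg_ops)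
      then show ?thesis
        using that G'[rule_format, OF that] insert.hyps by (auto simp: U_def unit_el_def t)
    qed
    have "plus_el (alg i) G U \<in> carrier (alg i)"
      unfolding carrier_alg
    proof (intro conjI allI impI)
      show "plus_el (alg i) G U \<in> Y i \<rightarrow>\<^sub>E carrier_mat (N i) (N i)"
        using Gy by (auto simp: alg_ops)
      fix p q assume pq: "p < N i" "q < N i"
      show "continuous_on (Y i) (\<lambda>y. plus_el (alg i) G U y $$ (p, q))"
        using pq F by (cases "(p, q) \<in> insert t T") (simp_all add: sum carrier_alg cong: continuous_on_cong)
    qed
    moreover have "\<psi> i (plus_el (alg i) G U) \<in> S"
      using G U by (simp add: \<psi>_plus)
    ultimately show ?case using sum by blast
  qed
  from this[of "{..<N i} \<times> {..<N i}"] obtain G where G: "G \<in> carrier (alg i)" "\<psi> i G \<in> S"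
    "\<And>y p q. y \<in> Y i \<Longrightarrow> p < N i \<Longrightarrow> q < N i \<Longrightarrow> G y $$ (p, q) = F y $$ (p, q)"
    by auto
  then have "G = F" using F by (intro alg_eqI) auto
  then show ?thesis using G by simp
qed

text \<open>Iterating \<open>\<phi>_diag_el\<close> from level 0 composes \<open>f\<close> with the
  maps \<open>base i p\<close>, and the canonical maps are compatible with the connecting
  maps.\<close>

lemma \<psi>_base:
  assumes "continuous_on (Y 0) f"
  shows "\<psi> i (diag_el i (\<lambda>p y. f (base i p y))) = \<psi> 0 (diag_el 0 (\<lambda>p. f))"
proof (induction i)
  case (Suc i)
  have c: "continuous_on (Y i) (\<lambda>y. f (base i p y))" if "p < N i" for p
    by (rule continuous_on_compose2[OF assms base_continuous[OF that]]) (use base_in that in auto)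
  then have "diag_el i (\<lambda>p y. f (base i p y)) \<in> carrier (alg i)" by simp
  then show ?case
    using Suc \<psi>_\<phi> \<phi>_diag_el[of i "\<lambda>p y. f (base i p y)"] c by fastforce
qed simp

section \<open>Generation by matrix units and distance functions\<close>

text \<open>Matrix units move any diagonal entry into the corner (0, 0). The entries of the given
  elements include the distance of every coordinate to every \<open>z n\<close>; these functions
  separate points, so Stone-Weierstrass puts all real functions of that corner into
  \<open>S\<close>. Complex functions, all other entries and, by density, all of \<open>B\<close>
  follow.\<close>

lemma subalgebra_eq_carrier:
  assumes sub: "cstar_subalgebra B S"
    and units: "\<And>i a b. a < N i \<Longrightarrow> b < N i \<Longrightarrow> \<psi> i (unit_el i a b (\<lambda>_. 1)) \<in> S"
    and f: "\<And>n. \<psi> 0 (diag_el 0 (\<lambda>p y. complex_of_real (dist (y 0) (z n)))) \<in> S"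
    and z: "\<And>u e. u \<in> X \<Longrightarrow> e > 0 \<Longrightarrow> \<exists>n::nat. dist u (z n) < e"
  shows "S = carrier B"
proof -
  interpret cstar_sub B S by unfold_locales (rule sub)
  have dc: "continuous_on Z (\<lambda>y. dist (y q) (z n))" for Z n and q :: nat
    by (intro continuous_on_dist continuous_on_const
        continuous_on_subset[OF continuous_on_product_coordinates] subset_UNIV)
  then have cf: "continuous_on Z (\<lambda>y. complex_of_real (dist (y q) (z n)))" for Z n and q :: nat
    by (intro continuous_on_of_real)
  have coord: "\<psi> i (unit_el i 0 0 (\<lambda>y. complex_of_real (dist (y q) (z n)))) \<in> S" if "q < D i" for i q n
  proof -
    obtain p where p: "p < N i" "\<And>y. y \<in> Y i \<Longrightarrow> base i p y 0 = y q"
      using base_coordinate[OF \<open>q < D i\<close>] by blast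
    let ?d = "diag_el i (\<lambda>p y. complex_of_real (dist (base i p y 0) (z n)))"
    have d: "?d \<in> carrier (alg i)"
      by (rule diag_el_carrier, rule continuous_on_compose2[OF cf[of "Y 0" 0 n] base_continuous])
        (use base_in in auto)
    have "\<psi> i ?d \<in> S" using f[of n] \<psi>_base[OF cf, of i 0 n] by simp
    then have "\<psi> i (unit_el i 0 p (\<lambda>_. 1)) \<^bold>* \<psi> i ?d \<^bold>* \<psi> i (unit_el i p 0 (\<lambda>_. 1)) \<in> S"
      using units N_pos p by simp
    moreover have "unit_el i 0 p (\<lambda>y. complex_of_real (dist (base i p y 0) (z n)))
        = unit_el i 0 p (\<lambda>y. complex_of_real (dist (y q) (z n)))"
      using p by (intro unit_el_cong) simp
    ultimately show ?thesis
      using d p N_pos[of i] cf[of "Y i" q n]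
      by (simp add: unit_times_diag unit_el_times flip: \<psi>_times)
  qed
  have real: "\<psi> i (unit_el i 0 0 (\<lambda>y. complex_of_real (g y))) \<in> S" if g: "continuous_on (Y i) g" for i g
  proof -
    \<comment> \<open>Stone-Weierstrass is applied to real functions; products in \<open>R\<close>
      correspond to products in the corner (0, 0).\<close>
    define R where "R = {g. continuous_on (Y i) g \<and> \<psi> i (unit_el i 0 0 (\<lambda>y. complex_of_real (g y))) \<in> S}"
    interpret function_ring_on R "Y i"
    proof
      show "compact (Y i)" by (rule Y_compact)
    next
      fix h assume "h \<in> R"
      then show "continuous_on (Y i) h" unfolding R_def by blast
    next
      fix g h assume "g \<in> R" "h \<in> R"
      then have gh: "continuous_on (Y i) g" "continuous_on (Y i) h"
        "\<psi> i (unit_el i 0 0 (\<lambda>y. complex_of_real (g y))) \<in> S"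
        "\<psi> i (unit_el i 0 0 (\<lambda>y. complex_of_real (h y))) \<in> S"
        by (auto simp: R_def)
      then have c: "continuous_on (Y i) (\<lambda>y. complex_of_real (g y))" "continuous_on (Y i) (\<lambda>y. complex_of_real (h y))"
        by (auto intro: continuous_intros)
      have "\<psi> i (unit_el i 0 0 (\<lambda>y. complex_of_real (g y))) \<^bold>+ \<psi> i (unit_el i 0 0 (\<lambda>y. complex_of_real (h y))) \<in> S"
        using gh by simp
      then show "(\<lambda>y. g y + h y) \<in> R"
        using c gh by (simp add: R_def unit_el_plus continuous_on_add flip: \<psi>_plus)
      have "\<psi> i (unit_el i 0 0 (\<lambda>y. complex_of_real (g y))) \<^bold>* \<psi> i (unit_el i 0 0 (\<lambda>y. complex_of_real (h y))) \<in> S"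
        using gh by simp
      then show "(\<lambda>y. g y * h y) \<in> R"
        using c gh N_pos[of i] by (simp add: R_def unit_el_times continuous_on_mult flip: \<psi>_times)
    next
      fix a :: real
      have "complex_of_real a \<^bold>\<cdot> \<psi> i (unit_el i 0 0 (\<lambda>_. 1)) \<in> S"
        using units N_pos[of i] by simp
      then show "(\<lambda>_. a) \<in> R"
        by (simp add: R_def unit_el_scale flip: \<psi>_scale)
    next
      fix y y' assume y: "y \<in> Y i" "y' \<in> Y i" "y \<noteq> y'"
      then obtain q where q: "q < D i" "y q \<noteq> y' q"
        unfolding villadsen_space_def using PiE_ext by (metis lessThan_iff)
      have "y q \<in> X" using q y Y_index by simp
      moreover have "dist (y q) (y' q) / 2 > 0" using q by simp
      \<comment> \<open>By the triangle inequality, a point closer to \<open>y q\<close> than half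
        the distance from \<open>y q\<close> to \<open>y' q\<close> is farther from
        \<open>y' q\<close>.\<close>
      ultimately obtain n where n: "dist (y q) (z n) < dist (y q) (y' q) / 2"
        using z by blast
      then have "dist (y q) (z n) \<noteq> dist (y' q) (z n)"
        using dist_triangle2[of "y q" "y' q" "z n"] by auto
      moreover have "(\<lambda>y. dist (y q) (z n)) \<in> R"
        using coord[OF q(1), of n] dc[of "Y i" q n] by (simp add: R_def)
      ultimately show "\<exists>f\<in>R. f y \<noteq> f y'"
        by (rule bexI[of "\<lambda>f. f y \<noteq> f y'"])
    qed
    have "\<forall>n. \<exists>h. h \<in> R \<and> (\<forall>y\<in>Y i. \<bar>g y - h y\<bar> < (1/2)^n)"
    proof
      fix n :: nat
      have "(0::real) < (1/2)^n" by simp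
      from Stone_Weierstrass_basic[OF g this]
      show "\<exists>h. h \<in> R \<and> (\<forall>y\<in>Y i. \<bar>g y - h y\<bar> < (1/2)^n)" by blast
    qed
    from choice[OF this] obtain h where h: "\<And>n. h n \<in> R" "\<And>n y. y \<in> Y i \<Longrightarrow> \<bar>g y - h n y\<bar> < (1/2)^n"
      by blast
    have hc: "continuous_on (Y i) (h n)" for n using h(1)[of n] by (simp add: R_def)
    have "tends (\<lambda>n. \<psi> i (unit_el i 0 0 (\<lambda>y. complex_of_real (h n y)))) (\<psi> i (unit_el i 0 0 (\<lambda>y. complex_of_real (g y))))"
    proof (rule tends_halving[where K = 1])
      fix n
      have c: "continuous_on (Y i) (\<lambda>y. complex_of_real (h n y))" "continuous_on (Y i) (\<lambda>y. complex_of_real (g y))"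
        using hc g by (auto intro: continuous_intros)
      have "\<psi> i (unit_el i 0 0 (\<lambda>y. complex_of_real (h n y))) \<^bold>+ (-1) \<^bold>\<cdot> \<psi> i (unit_el i 0 0 (\<lambda>y. complex_of_real (g y)))
        = \<psi> i (unit_el i 0 0 (\<lambda>y. complex_of_real (h n y) + (-1) * complex_of_real (g y)))"
        unfolding \<psi>_unit_scale[OF c(2)]
        by (rule \<psi>_unit_plus) (intro c continuous_on_mult continuous_on_const)+
      \<comment> \<open>Elements of the corner (0, 0) are diagonal, so the norm bound for diagonal
        elements applies.\<close>
      moreover have "nrm (\<psi> i (unit_el i 0 0 (\<lambda>y. complex_of_real (h n y) + (-1) * complex_of_real (g y)))) \<le> (1/2)^n"
        unfolding unit_el_diag
      proof (rule norm_\<psi>_diag_le)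
        fix p y assume "y \<in> Y i"
        then have "cmod (complex_of_real (h n y) + (-1) * complex_of_real (g y)) \<le> (1/2)^n"
          using h(2)[of y n] by (simp add: abs_minus_commute less_imp_le flip: of_real_diff)
        then show "cmod (if p = 0 then complex_of_real (h n y) + (-1) * complex_of_real (g y) else 0) \<le> (1/2)^n"
          by simp
      next
        fix p :: nat
        show "continuous_on (Y i) (\<lambda>y. if p = 0 then complex_of_real (h n y) + (-1) * complex_of_real (g y) else 0)"
          using c by (cases "p = 0") (auto intro!: continuous_intros)
      qed simp
      ultimately show "dist_el B (\<psi> i (unit_el i 0 0 (\<lambda>y. complex_of_real (h n y)))) (\<psi> i (unit_el i 0 0 (\<lambda>y. complex_of_real (g y)))) \<le> 1 * (1/2)^n"
        by (simp add: dist_el_def)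
    qed (use hc g in \<open>auto intro!: \<psi>_closed unit_el_carrier continuous_intros\<close>)
    then show ?thesis
      by (rule sub_tends) (use h(1) in \<open>simp add: R_def\<close>)
  qed
  have unit: "\<psi> i (unit_el i a b g) \<in> S" if ab: "a < N i" "b < N i" and g: "continuous_on (Y i) g" for i a b g
  proof -
    have c: "continuous_on (Y i) (\<lambda>y. Re (g y))" "continuous_on (Y i) (\<lambda>y. Im (g y))"
      using g by (auto intro: continuous_intros)
    then have c': "continuous_on (Y i) (\<lambda>y. complex_of_real (Re (g y)))" "continuous_on (Y i) (\<lambda>y. complex_of_real (Im (g y)))"
      by (auto intro: continuous_intros)
    have "\<psi> i (unit_el i 0 0 (\<lambda>y. complex_of_real (Re (g y)))) \<^bold>+ \<i> \<^bold>\<cdot> \<psi> i (unit_el i 0 0 (\<lambda>y. complex_of_real (Im (g y)))) \<in> S"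
      using real c by simp
    moreover have "\<psi> i (unit_el i 0 0 (\<lambda>y. complex_of_real (Re (g y)))) \<^bold>+ \<i> \<^bold>\<cdot> \<psi> i (unit_el i 0 0 (\<lambda>y. complex_of_real (Im (g y))))
        = \<psi> i (unit_el i 0 0 g)"
      unfolding \<psi>_unit_scale[OF c'(2)]
      by (subst \<psi>_unit_plus) (use c' in \<open>auto intro: continuous_on_mult simp: complex_eq[symmetric]\<close>)
    ultimately have "\<psi> i (unit_el i a 0 (\<lambda>_. 1)) \<^bold>* \<psi> i (unit_el i 0 0 g) \<^bold>* \<psi> i (unit_el i 0 b (\<lambda>_. 1)) \<in> S"
      using units ab N_pos[of i] by simp
    then show ?thesis
      using ab N_pos[of i] g by (simp add: unit_el_times flip: \<psi>_times)
  qed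
  have "\<psi> i F \<in> S" if "F \<in> carrier (alg i)" for i F
    using \<psi>_entries[OF sub that] unit that by (simp add: carrier_alg)
  moreover have "b \<in> S" if b: "b \<in> carrier B" for b
  proof -
    have "\<exists>a\<in>S. dist_el B a b \<le> 1 * (1/2)^n" for n
      using \<psi>_dense[OF b, of "(1/2)^n"] calculation by (force simp: less_imp_le)
    then obtain u where u: "\<And>n. u n \<in> S" "\<And>n. dist_el B (u n) b \<le> 1 * (1/2)^n" by metis
    have "tends u b" by (rule tends_halving[OF _ b u(2)]) (use u sub_carrier in auto)
    then show ?thesis by (rule sub_tends) (use u in auto)
  qed
  ultimately show ?thesis using sub_carrier by blast
qed


section \<open>The tree of matrix units in the limit\<close>

lemma \<psi>_unit_times:
  assumes "continuous_on (Y i) f" "continuous_on (Y i) g" "a < N i" "b < N i" "b' < N i"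
  shows "\<psi> i (unit_el i a b f) \<^bold>* \<psi> i (unit_el i b' d g)
    = (if b = b' then \<psi> i (unit_el i a d (\<lambda>y. f y * g y)) else \<^bold>0)"
  using assms by (simp add: unit_el_times flip: \<psi>_times)

text \<open>A level with the unit as its only matrix unit is prepended, so that the matrix units of the
  first algebra are also reached by edges between siblings.\<close>

definition units :: "nat \<Rightarrow> nat \<Rightarrow> nat \<Rightarrow> 'b" where
  "units i a b = (case i of 0 \<Rightarrow> \<psi> 0 (diag_el 0 (\<lambda>_ _. 1)) | Suc i \<Rightarrow> \<psi> i (unit_el i a b (\<lambda>_. 1)))"

definition level_size :: "nat \<Rightarrow> nat" where
  "level_size i = (case i of 0 \<Rightarrow> 1 | Suc i \<Rightarrow> N i)"

definition level_par :: "nat \<Rightarrow> nat \<Rightarrow> nat" where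
  "level_par i a = (case i of 0 \<Rightarrow> 0 | Suc i \<Rightarrow> par i a)"

definition level_last :: "nat \<Rightarrow> nat \<Rightarrow> nat" where
  "level_last i a = (case i of 0 \<Rightarrow> 0 | Suc i \<Rightarrow> child i (l i + k i - 1) a)"

lemmas level_defs = units_def level_size_def level_par_def level_last_def

text \<open>The coarser unit is first pushed to the next level by \<open>\<phi>\<close>, where the
  product can be computed.\<close>

lemma units_child:
  assumes "a < N i" "b < N i" "t < l i + k i"
  shows "units (Suc i) a b \<^bold>* units (Suc (Suc i)) (child i t b) (child i t b)
    = units (Suc (Suc i)) (child i t a) (child i t b)"
proof -
  have "\<psi> i (unit_el i a b (\<lambda>_. 1)) = \<psi> (Suc i) (\<phi> i (unit_el i a b (\<lambda>_. 1)))"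
    by (simp add: \<psi>_\<phi>)
  moreover have "\<phi> i (unit_el i a b (\<lambda>_. 1)) \<in> carrier (alg (Suc i))"
    by (rule \<phi>_closed) simp
  ultimately show ?thesis
    using assms by (simp add: units_def \<phi>_unit_times_unit flip: \<psi>_times)
qed

text \<open>The matrix units and the scaled images of distance functions form a
  \<open>matrix_unit_system\<close>; by \<open>subalgebra_eq_carrier\<close>, a closed subalgebra
  containing its generator is all of \<open>B\<close>.\<close>

lemma limit_singly_generated: "singly_generated B"
proof -
  obtain z :: "nat \<Rightarrow> 'a" where z: "\<And>u e. u \<in> X \<Longrightarrow> e > 0 \<Longrightarrow> \<exists>n. dist u (z n) < e"
    using dense_sequence[OF X_compact] by blast
  \<comment> \<open>\<open>D 0\<close> is 1, so \<open>y 0\<close> is the only coordinate of a point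
    of \<open>Y 0\<close>.\<close>
  define f where "f n y = complex_of_real (dist (y 0) (z n))" for n and y :: "nat \<Rightarrow> 'a"
  have f: "continuous_on Z (f n)" for Z n
    unfolding f_def
    by (intro continuous_on_of_real continuous_on_dist continuous_on_const
        continuous_on_subset[OF continuous_on_product_coordinates] subset_UNIV)
  define G where "G n = \<psi> 0 (diag_el 0 (\<lambda>p. f n))" for n
  define d where "d n i = diag_el i (\<lambda>p y. f n (base i p y))" for n i
  have f_base: "continuous_on (Y i) (\<lambda>y. f n (base i p y))" if "p < N i" for n i p
    by (rule continuous_on_compose2[OF f[of "Y 0"] base_continuous[OF that]]) (use base_in that in auto)
  have d: "d n i \<in> carrier (alg i)" for n i
    unfolding d_def using f_base by simp
  have G: "G n = \<psi> i (d n i)" for n i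
    unfolding G_def d_def by (rule \<psi>_base[OF f, symmetric])
  have Gc: "G n \<in> carrier B" "star (G n) = G n" for n
  proof -
    show "G n \<in> carrier B" using G[of n 0] d by simp
    have "star (\<psi> 0 (d n 0)) = \<psi> 0 (star_el (alg 0) (d n 0))"
      using d by (simp add: \<psi>_star)
    then show "star (G n) = G n"
      unfolding G[of n 0] by (simp add: d_def diag_el_star f_def)
  qed
  have G_unit: "G n \<^bold>* \<psi> i (unit_el i a b (\<lambda>_. 1)) = \<psi> i (unit_el i a b (\<lambda>y. f n (base i a y)))"
    and unit_G: "\<psi> i (unit_el i a b (\<lambda>_. 1)) \<^bold>* G n = \<psi> i (unit_el i a b (\<lambda>y. f n (base i b y)))"
    if "a < N i" "b < N i" for n i a b
    using d[of n i] that
    by (simp_all add: G[of n i] d_def diag_times_unit unit_times_diag flip: \<psi>_times)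
  \<comment> \<open>The factor 4 gives the bound 1/4; the summand 1 covers the case that
    \<open>G n\<close> is zero.\<close>
  define \<alpha> where "\<alpha> n = 1 / (4 * (1 + nrm (G n)))" for n
  have \<alpha>: "\<alpha> n > 0" "\<alpha> n * nrm (G n) \<le> 1/4" for n
    using norm_nonneg[OF Gc(1)[of n]] by (auto simp: \<alpha>_def field_simps add_pos_nonneg)
  \<comment> \<open>The shift matches the prepended level: the step from level \<open>n + 1\<close>
    to level \<open>n + 2\<close> of the system is the connecting map \<open>\<phi> n\<close>, whose
    last block makes \<open>G n\<close> scalar on the last children. The first step comes from no
    connecting map, hence \<open>F 0\<close> is zero.\<close>
  define F where "F j = (case j of 0 \<Rightarrow> \<^bold>0 | Suc n \<Rightarrow> complex_of_real (\<alpha> n) \<^bold>\<cdot> G n)" for j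
  let ?one = "\<psi> 0 (diag_el 0 (\<lambda>_ _. 1))"
  interpret matrix_unit_system B level_size units level_par level_last F
  proof unfold_locales
    fix r i s s' t
    show "units i r s \<in> carrier B" if "r < level_size i" "s < level_size i"
      by (cases i) (simp_all add: units_def)
    show "units i r s \<^bold>* units i s' t = (if s = s' then units i r t else \<^bold>0)"
      if "r < level_size i" "s < level_size i" "s' < level_size i" "t < level_size i"
    proof (cases i)
      case 0
      have "?one \<^bold>* ?one = ?one"
        by (simp add: diag_el_times flip: \<psi>_times)
      then show ?thesis using that 0 by (simp add: level_defs)
    next
      case (Suc j)
      then show ?thesis using that by (simp add: level_defs \<psi>_unit_times)
    qed
    show "star (units i r s) = units i s r"
      by (cases i) (simp_all add: units_def unit_el_star diag_el_star flip: \<psi>_star)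
    show "level_par i s < level_size i" if "s < level_size (Suc i)"
      by (cases i) (simp_all add: level_defs par_less)
    show "level_last i r < level_size (Suc i)" if "r < level_size i"
      using that N_pos l_pos by (cases i) (simp_all add: level_defs child_less add_pos_nonneg Suc_le_eq)
    show "level_par i (level_last i r) = r" if "r < level_size i"
      using that by (cases i) (simp_all add: level_defs par_child)
    show "units i (level_par i s) (level_par i s) \<^bold>* units (Suc i) s s = units (Suc i) s s"
      if "s < level_size (Suc i)"
    proof (cases i)
      case 0
      then show ?thesis using that by (simp add: level_defs diag_times_unit flip: \<psi>_times)
    next
      case (Suc j)
      then show ?thesis
        using that units_child[OF par_less par_less dig_less, of s j s s]
        by (simp add: level_par_def level_size_def child_par_dig)
    qed
    show "units i r s \<^bold>* units (Suc i) (level_last i s) (level_last i s)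
      = units (Suc i) (level_last i r) (level_last i s)"
      if "r < level_size i" "s < level_size i"
    proof (cases i)
      case 0
      then show ?thesis using N_pos by (simp add: level_defs diag_times_unit flip: \<psi>_times)
    next
      case (Suc j)
      then show ?thesis
        using that units_child[of r j s "l j + k j - 1"] l_pos[of j] by (simp add: level_last_def level_size_def)
    qed
  next
    fix j r
    show "F j \<in> carrier B" "star (F j) = F j"
      using Gc by (auto simp: F_def star_scale split: nat.split)
    show "nrm (F j) \<le> 1/4"
      using \<alpha> Gc by (auto simp: F_def norm_scale less_imp_le abs_of_pos split: nat.split)
    show "\<exists>z. F j \<^bold>* units (Suc j) (level_last j r) (level_last j r)
        = z \<^bold>\<cdot> units (Suc j) (level_last j r) (level_last j r)" if r: "r < level_size j"
    proof (cases j)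
      case 0
      then show ?thesis by (intro exI[of _ 0]) (simp add: F_def units_def)
    next
      case (Suc i)
      define q where "q = child i (l i + k i - 1) r"
      have r: "r < N i" using r Suc by (simp add: level_size_def)
      have q: "q < N (Suc i)" unfolding q_def using r l_pos[of i] by (intro child_less) auto
      have "G i \<^bold>* \<psi> (Suc i) (unit_el (Suc i) q q (\<lambda>_. 1))
          = \<psi> (Suc i) (unit_el (Suc i) q q (\<lambda>y. f i (base i r (x i (k i - 1))) * 1))"
        using q base_last[OF r] by (simp only: G_unit q_def mult_1_right)
      also have "\<dots> = f i (base i r (x i (k i - 1))) \<^bold>\<cdot> \<psi> (Suc i) (unit_el (Suc i) q q (\<lambda>_. 1))"
        by (simp add: \<psi>_unit_scale)
      finally show ?thesis
        using Gc Suc by (auto simp: F_def units_def level_last_def q_def scale_times scale_scale)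
    qed
  next
    fix r i j
    show "units i r r \<^bold>* F j = F j \<^bold>* units i r r" if "r < level_size i"
    proof (cases j)
      case 0
      then show ?thesis by (cases i) (simp_all add: F_def units_def)
    next
      case (Suc n)
      have "units i r r \<^bold>* G n = G n \<^bold>* units i r r"
      proof (cases i)
        case 0
        have "?one \<^bold>* \<psi> 0 (d n 0) = \<psi> 0 (d n 0) \<^bold>* ?one"
          using d[of n 0] by (simp add: d_def diag_el_times flip: \<psi>_times)
        then show ?thesis by (simp add: 0 units_def G[of n 0])
      next
        case (Suc i')
        then show ?thesis using that by (simp add: level_defs unit_G G_unit)
      qed
      moreover have "units i r r \<in> carrier B"
        by (cases i) (simp_all add: units_def)
      ultimately show ?thesis
        using Gc Suc by (simp add: F_def times_scale scale_times)
    qed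
  qed (simp add: level_size_def)
  obtain b where b: "b \<in> carrier B" and gen: "\<forall>S. cstar_subalgebra B S \<longrightarrow> b \<in> S \<longrightarrow>
      (\<forall>i r s. r < level_size i \<longrightarrow> s < level_size i \<longrightarrow> units i r s \<in> S) \<and>
      (\<forall>j s. s < level_size (Suc j) \<longrightarrow> F j \<^bold>* units (Suc j) s s \<in> S)"
    using generator_exists by (elim bexE)
  have "S = carrier B" if S: "cstar_subalgebra B S" "b \<in> S" for S
  proof (rule subalgebra_eq_carrier[OF S(1) _ _ z])
    interpret cstar_sub B S by unfold_locales (rule S)
    fix i p q assume "p < N i" "q < N i"
    then show "\<psi> i (unit_el i p q (\<lambda>_. 1)) \<in> S"
      using gen[rule_format, OF S, THEN conjunct1, rule_format, of p "Suc i" q] by (simp add: level_defs)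
  next
    interpret cstar_sub B S by unfold_locales (rule S)
    fix n
    \<comment> \<open>\<open>G n\<close> is reassembled at level \<open>n + 1\<close>, where the
      generator yields its diagonal entries up to the factor \<open>\<alpha> n\<close>.\<close>
    have "\<psi> (Suc n) (d n (Suc n)) \<in> S"
    proof (rule \<psi>_entries[OF S(1) d])
      fix p q assume pq: "p < N (Suc n)" "q < N (Suc n)"
      have e: "unit_el (Suc n) p q (\<lambda>y. d n (Suc n) y $$ (p, q))
          = unit_el (Suc n) p q (\<lambda>y. if p = q then f n (base (Suc n) p y) else 0)"
        using pq by (intro unit_el_cong) (simp add: d_def diag_el_def)
      show "\<psi> (Suc n) (unit_el (Suc n) p q (\<lambda>y. d n (Suc n) y $$ (p, q))) \<in> S"
      proof (cases "p = q")
        case True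
        have "F (Suc n) \<^bold>* units (Suc (Suc n)) p p \<in> S"
          using gen[rule_format, OF S, THEN conjunct2, rule_format] pq by (simp add: level_size_def)
        then have "complex_of_real (\<alpha> n) \<^bold>\<cdot> \<psi> (Suc n) (unit_el (Suc n) p p (\<lambda>y. f n (base (Suc n) p y))) \<in> S"
          using Gc pq by (simp add: F_def units_def scale_times G_unit del: base.simps)
        from sub_scale[OF this, of "complex_of_real (1 / \<alpha> n)"] show ?thesis
          using \<alpha>(1)[of n] f_base[OF pq(1)] unfolding e
          by (simp add: True scale_scale del: base.simps)
      next
        case False
        then show ?thesis
          unfolding e using zero_unit_el[of "Suc n" p q, symmetric] by (simp del: base.simps)
      qed
    qed
    moreover have "f n = (\<lambda>y. complex_of_real (dist (y 0) (z n)))"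
      by (rule ext) (simp add: f_def)
    ultimately show "\<psi> 0 (diag_el 0 (\<lambda>p y. complex_of_real (dist (y 0) (z n)))) \<in> S"
      using G[of n "Suc n"] by (simp add: G_def)
  qed
  \<comment> \<open>This ensures that the intersection defining \<open>cstar_generated\<close> is
    not taken over an empty family.\<close>
  moreover have "cstar_subalgebra B (carrier B)"
    unfolding cstar_subalgebra_def by auto
  ultimately have "cstar_generated B b = carrier B"
    unfolding cstar_generated_def using b by blast
  then show ?thesis unfolding singly_generated_def using b by blast
qed

end

theorem corollary3p2:
  fixes B :: "'b star_algebra"
    and X :: "'a::metric_space set"
    and c k l :: "nat \<Rightarrow> nat"
    and s :: "nat \<Rightarrow> nat \<Rightarrow> nat"
    and x :: "nat \<Rightarrow> nat \<Rightarrow> nat \<Rightarrow> 'a"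
    and n0 :: nat
    and \<sigma> :: "nat \<Rightarrow> nat \<Rightarrow> nat"
  assumes "is_villadsen_algebra X c k l s x n0 \<sigma> B"
  shows "singly_generated B"
proof -
  obtain \<psi> where \<psi>: "villadsen_data X c k l s x n0 \<sigma>"
    "inductive_limit (villadsen_block X c k l n0) (villadsen_map X c k l s x n0 \<sigma>) B \<psi>"
    using assms unfolding is_villadsen_algebra_def by blast
  interpret villadsen_data X c k l s x n0 \<sigma> by (rule \<psi>(1))
  interpret cstar_algebra B using \<psi>(2) by (simp add: inductive_limit_def)
  interpret villadsen_limit X c k l s x n0 \<sigma> B \<psi>
    by unfold_locales (rule \<psi>(2))
  show ?thesis by (rule limit_singly_generated)
qed

end
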